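(* Let $(Y_i)_{i\ge1}$ be i.i.d. with $Y_1\in[0,R]$ almost surely and $\mathrm{Var}(Y_1)=\sigma^2>0$ (so $\sigma\le R/2$), and let $0<k<n$ be integers. Let $\tilde K_{R,\sigma}$ be the explicit constant, depending only on $R$ and $\sigma$, defined in the context. Then for all $t\ge\frac{4e\tilde K_{R,\sigma}}{\sigma_{n,k}}+2$, $$\mathbb P\Big(\frac1{\sigma_{n,k}}W_k\ge t\Big)\le\Phi^c(t)\Big[1+\frac{e\tilde K_{R,\sigma}\varphi(t)}{\Phi^c(t)\sigma_{n,k}}\Big]\Big(\frac{e\tilde K_{R,\sigma}\varphi(t)}{\sigma_{n,k}}\Big)^{-\frac{e\tilde K_{R,\sigma}(t+1)}{e\tilde K_{R,\sigma}(t+1)+\sigma_{n,k}}}.$$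
   Context: $X_i=Y_i-\mathbb E[Y_i]$, $S_k=\sum_{i\le k}X_i$, $W_k=S_k-\frac knS_n$, $\sigma_{n,k}^2=\sigma^2\frac{k(n-k)}{n}$. $\varphi$ and $\Phi$ are the standard normal density and distribution function, $\Phi^c=1-\Phi$. $a\vee b=\max(a,b)$. Put $\tilde R=R/\sigma$, $R_s=\frac12(R+\sqrt{R^2-4\sigma^2})$, $\tilde R_s=R_s/\sigma$. For $p\ge2$ and an integer $m\ge1$ let $$K(p,m)=\tfrac12(\sigma+\sqrt2R)\vee\max\Big(\tfrac R\sigma,\ T_1+T_2+T_3+T_4+T_5+1\Big),$$ where $$T_1=\tfrac{3\sigma}{4}\Big(\sqrt{\tilde R_s^2-1}\,\tfrac{\sqrt e(2e)^{1/2}}{\sqrt2}+\tfrac{\pi^{1/4}e^{19/300}}{4\sqrt3}\big[e^{\tilde R^2/2}-1\big]\Big),$$ $$T_2=\sigma\sqrt2\,(1+\log 4)\,\tfrac{\tilde R^{1-2/p}(\sqrt{8\pi})^{1/2}}{3\sqrt e}\,e^{19/300}\pi^{1/4}\big[e^{\tilde R^2/2}-1\big],$$ $$T_3=\sqrt4\,\sigma\,\tfrac{(\max(\tilde R_s^2-1,1))^{1/2}}{\sqrt2},\qquad T_4=\sigma\tilde R\,\sqrt e(2e)^{1/2}\,\tfrac{\pi^{1/4}e^{19/300}}{4\sqrt3}\big[e^{\tilde R^2/2}-1\big],$$ $$T_5=\tfrac{4\sigma\tilde R^{2-2/p}}{\sqrt{2m}}\,\tfrac{\pi^{1/4}e^{19/300}}{4\sqrt3}\big[e^{\tilde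 R^2/2}-1\big].$$ Further let $$\tilde K(p,m)=\Big\{K(p,m)+\tfrac{R^2}{\sigma}\big(1+\tfrac\sigma2\big)+2^{3/p}\sigma^{2/p-1}\tfrac{e^{19/300}\pi^{1/4}}{3}\tfrac{R^2}{2}\big(e^{R^2}-1\big)\log\Big(\tfrac{1+\sqrt{1/2}}{1-\sqrt{1/2}}\Big)$$ $$\qquad+R^{-4/p}\Big[\tilde R^{2/p}4^{1/p}\sigma^{-1}+2\Big]\tfrac{e^{19/300}\pi^{1/4}}{8\sqrt3}\tfrac{R^{5/2}}{\sqrt2}\big(e^{R^2}-1\big)\Big\}\vee\big(1+\sqrt2R\sigma^{-1}\big).$$ Then $\tilde K_{R,\sigma}=\sup_{p\ge2,\,m\ge1}\tilde K(p,m)<\infty$. *)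

theory Defs
  imports "HOL-Probability.Probability"
begin

text \<open>
  The sequence is indexed from 1, so the value of \<open>Y\<close> at index 0 is never used.
\<close>

definition centred :: "'a measure \<Rightarrow> (nat \<Rightarrow> 'a \<Rightarrow> real) \<Rightarrow> nat \<Rightarrow> 'a \<Rightarrow> real" where
  "centred M Y i \<omega> = Y i \<omega> - prob_space.expectation M (Y i)"

definition centred_sum :: "'a measure \<Rightarrow> (nat \<Rightarrow> 'a \<Rightarrow> real) \<Rightarrow> nat \<Rightarrow> 'a \<Rightarrow> real" where
  "centred_sum M Y k \<omega> = (\<Sum>i = 1..k. centred M Y i \<omega>)"

definition bridge :: "'a measure \<Rightarrow> (nat \<Rightarrow> 'a \<Rightarrow> real) \<Rightarrow> nat \<Rightarrow> nat \<Rightarrow> 'a \<Rightarrow> real" where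
  "bridge M Y n k \<omega> = centred_sum M Y k \<omega> - real k / real n * centred_sum M Y n \<omega>"

definition bridge_sd :: "real \<Rightarrow> nat \<Rightarrow> nat \<Rightarrow> real" where
  "bridge_sd \<sigma> n k = sqrt (\<sigma>\<^sup>2 * (real k * (real n - real k) / real n))"

definition std_normal_tail :: "real \<Rightarrow> real" where
  "std_normal_tail t = 1 - cdf std_normal_distribution t"

text \<open>
  Real exponents are written with \<open>powr\<close>; every base is positive when
  \<open>0 < \<sigma>\<close> and \<open>2 * \<sigma> \<le> R\<close>, and the radicands are then nonnegative.
\<close>

definition R_rel :: "real \<Rightarrow> real \<Rightarrow> real" where
  "R_rel R \<sigma> = R / \<sigma>"

definition Rs :: "real \<Rightarrow> real \<Rightarrow> real" where
  "Rs R \<sigma> = 1 / 2 * (R + sqrt (R\<^sup>2 - 4 * \<sigma>\<^sup>2))"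

definition Rs_rel :: "real \<Rightarrow> real \<Rightarrow> real" where
  "Rs_rel R \<sigma> = Rs R \<sigma> / \<sigma>"

definition T1 :: "real \<Rightarrow> real \<Rightarrow> real" where
  "T1 R \<sigma> = 3 * \<sigma> / 4 *
     (sqrt ((Rs_rel R \<sigma>)\<^sup>2 - 1) * (sqrt (exp 1) * (2 * exp 1) powr (1/2) / sqrt 2)
      + pi powr (1/4) * exp (19/300) / (4 * sqrt 3) * (exp ((R_rel R \<sigma>)\<^sup>2 / 2) - 1))"

definition T2 :: "real \<Rightarrow> real \<Rightarrow> real \<Rightarrow> real" where
  "T2 R \<sigma> p = \<sigma> * sqrt 2 * (1 + ln 4)
     * (R_rel R \<sigma> powr (1 - 2/p) * sqrt (8 * pi) powr (1/2) / (3 * sqrt (exp 1)))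
     * exp (19/300) * pi powr (1/4) * (exp ((R_rel R \<sigma>)\<^sup>2 / 2) - 1)"

definition T3 :: "real \<Rightarrow> real \<Rightarrow> real" where
  "T3 R \<sigma> = sqrt 4 * \<sigma> * (max ((Rs_rel R \<sigma>)\<^sup>2 - 1) 1 powr (1/2) / sqrt 2)"

definition T4 :: "real \<Rightarrow> real \<Rightarrow> real" where
  "T4 R \<sigma> = \<sigma> * R_rel R \<sigma> * sqrt (exp 1) * (2 * exp 1) powr (1/2)
     * (pi powr (1/4) * exp (19/300) / (4 * sqrt 3)) * (exp ((R_rel R \<sigma>)\<^sup>2 / 2) - 1)"

definition T5 :: "real \<Rightarrow> real \<Rightarrow> real \<Rightarrow> nat \<Rightarrow> real" where
  "T5 R \<sigma> p m = 4 * \<sigma> * R_rel R \<sigma> powr (2 - 2/p) / sqrt (2 * real m)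
     * (pi powr (1/4) * exp (19/300) / (4 * sqrt 3)) * (exp ((R_rel R \<sigma>)\<^sup>2 / 2) - 1)"

definition K :: "real \<Rightarrow> real \<Rightarrow> real \<Rightarrow> nat \<Rightarrow> real" where
  "K R \<sigma> p m = max (1 / 2 * (\<sigma> + sqrt 2 * R))
     (max (R / \<sigma>) (T1 R \<sigma> + T2 R \<sigma> p + T3 R \<sigma> + T4 R \<sigma> + T5 R \<sigma> p m + 1))"

definition K_tilde :: "real \<Rightarrow> real \<Rightarrow> real \<Rightarrow> nat \<Rightarrow> real" where
  "K_tilde R \<sigma> p m = max
     (K R \<sigma> p m
      + R\<^sup>2 / \<sigma> * (1 + \<sigma> / 2)
      + 2 powr (3/p) * \<sigma> powr (2/p - 1) * (exp (19/300) * pi powr (1/4) / 3)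
          * (R\<^sup>2 / 2) * (exp (R\<^sup>2) - 1) * ln ((1 + sqrt (1/2)) / (1 - sqrt (1/2)))
      + R powr (-4/p) * (R_rel R \<sigma> powr (2/p) * 4 powr (1/p) * inverse \<sigma> + 2)
          * (exp (19/300) * pi powr (1/4) / (8 * sqrt 3))
          * (R powr (5/2) / sqrt 2) * (exp (R\<^sup>2) - 1))
     (1 + sqrt 2 * R * inverse \<sigma>)"

text \<open>
  The supremum is taken in the reals; \<open>bdd_above_K_tilde\<close> below shows that it is a genuine
  least upper bound.
\<close>

definition K_sup :: "real \<Rightarrow> real \<Rightarrow> real" where
  "K_sup R \<sigma> = (SUP (p, m) \<in> {2..} \<times> {1..}. K_tilde R \<sigma> p m)"

lemma bdd_above_K_tilde:
  assumes "0 < R" "0 < \<sigma>"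
  shows "bdd_above ((\<lambda>(p, m). K_tilde R \<sigma> p m) ` ({2..} \<times> {1..}))"
proof -
  define c where "c = pi powr (1/4) * exp (19/300) / (4 * sqrt 3)"
  define E where "E = exp ((R_rel R \<sigma>)\<^sup>2 / 2) - 1"
  define L where "L = ln ((1 + sqrt (1/2)) / (1 - sqrt (1/2)) :: real)"
  have R: "R_rel R \<sigma> > 0" using assms by (simp add: R_rel_def)
  \<comment> \<open>\<open>K_tilde\<close> is continuous in \<open>1 / p\<close> and \<open>1 / sqrt (2 * m)\<close>, which range over a compact set.\<close>
  define g where "g = (\<lambda>(u, v). max
     (max (1 / 2 * (\<sigma> + sqrt 2 * R))
     (max (R / \<sigma>) (T1 R \<sigma> + \<sigma> * sqrt 2 * (1 + ln 4)
       * (R_rel R \<sigma> powr (1 - 2*u) * sqrt (8 * pi) powr (1/2) / (3 * sqrt (exp 1)))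
       * exp (19/300) * pi powr (1/4) * E
       + T3 R \<sigma> + T4 R \<sigma> + 4 * \<sigma> * R_rel R \<sigma> powr (2 - 2*u) * v * c * E + 1))
      + R\<^sup>2 / \<sigma> * (1 + \<sigma> / 2)
      + 2 powr (3*u) * \<sigma> powr (2*u - 1) * (exp (19/300) * pi powr (1/4) / 3)
          * (R\<^sup>2 / 2) * (exp (R\<^sup>2) - 1) * L
      + R powr (-4*u) * (R_rel R \<sigma> powr (2*u) * 4 powr u * inverse \<sigma> + 2)
          * (exp (19/300) * pi powr (1/4) / (8 * sqrt 3))
          * (R powr (5/2) / sqrt 2) * (exp (R\<^sup>2) - 1))
     (1 + sqrt 2 * R * inverse \<sigma>))"
  have "continuous_on ({0..1/2} \<times> {0..1}) g"
    unfolding g_def split_beta using assms R by (intro continuous_intros) auto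
  then have "compact (g ` ({0..1/2} \<times> {0..1}))"
    by (intro compact_continuous_image compact_Times compact_Icc)
  then have bdd: "bdd_above (g ` ({0..1/2} \<times> {0..1}))"
    by (intro bounded_imp_bdd_above compact_imp_bounded)
  have "K_tilde R \<sigma> p m \<in> g ` ({0..1/2} \<times> {0..1})" if "p \<ge> 2" "m \<ge> 1" for p m
  proof (rule image_eqI)
    show "K_tilde R \<sigma> p m = g (1/p, 1 / sqrt (2 * real m))"
      by (simp add: K_tilde_def K_def T2_def T5_def g_def c_def E_def L_def)
    show "(1/p, 1 / sqrt (2 * real m)) \<in> {0..1/2} \<times> {0..1}"
      using that by (auto simp: field_simps)
  qed
  then show ?thesis
    by (intro bdd_above_mono[OF bdd]) auto
qed

end

theory Submission
  imports Defs
begin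

text \<open>
  The bridge, divided by its standard deviation \<open>s\<close>, is a sum \<open>W\<close> of independent centred variables
  of total variance 1, each supported in an interval of length at most \<open>\<beta> = R / s\<close>. Only two of the
  summands of the constant are needed: with \<open>p = 2\<close> and \<open>m = 1\<close>, \<open>T4 + T5\<close> alone gives
  \<open>c = e K / s \<ge> 20 \<beta>\<close>.

  If \<open>c (t + 1) \<ge> 1\<close>, Bernstein's inequality is already stronger than the claim. Otherwise Stein's
  method gives the moderate deviation bound
  \<open>P (W \<ge> t) \<le> \<Phi>\<^sup>c (t - \<beta>) (1 + O (\<beta> t\<^sup>3))\<close>: if \<open>g\<close> is minus the Stein solution for the indicator of
  \<open>[\<tau>, \<infinity>)\<close>, where \<open>\<tau> = t - \<beta>\<close>, then \<open>x \<mapsto> x g x\<close> is increasing and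
  \<open>P (W \<ge> \<tau> + \<beta>) \<le> \<Phi>\<^sup>c \<tau> + E [(W + \<beta>) g (W + \<beta>) - W g W]\<close>. The increment is at most
  \<open>\<beta> \<Phi>\<^sup>c \<tau> \<surd>(2 \<pi>)\<close> times a function comparable to \<open>(1 + x\<^sup>2) exp (x\<^sup>2 / 2)\<close> up to \<open>\<tau>\<close>, which is
  dominated by \<open>\<Sum>j. (1 + j\<^sup>2) exp (j x - j\<^sup>2 / 2)\<close> and hence controlled by exponential moments
  of \<open>W\<close>.
\<close>

subsection \<open>The Mills ratio\<close>

definition mills :: "real \<Rightarrow> real" where
  "mills x = std_normal_tail x / std_normal_density x"

text \<open>The derivative of \<open>x * mills x\<close>, and so the second derivative of
  \<open>mills\<close>. Its sign makes \<open>stein_prod\<close> monotone and its size bounds the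
  increments of \<open>stein_prod\<close>.\<close>

definition mills_remainder :: "real \<Rightarrow> real" where
  "mills_remainder x = (1 + x\<^sup>2) * mills x - x"

section \<open>The standard normal density and tail as differentiable functions\<close>

lemma std_normal_density_pos: "0 < std_normal_density x"
  by (rule normal_density_pos) simp

lemma inverse_std_normal_density: "1 / std_normal_density x = sqrt (2 * pi) * exp (x\<^sup>2 / 2)"
  by (simp add: std_normal_density_def exp_minus field_simps)

lemma DERIV_std_normal_density:
  "(std_normal_density has_real_derivative - x * std_normal_density x) (at x)"
  unfolding std_normal_density_def
  by (auto intro!: derivative_eq_intros simp: field_simps)

lemma tendsto_std_normal_density_at_top: "(std_normal_density \<longlongrightarrow> 0) at_top"
proof -
  have "filterlim (\<lambda>x::real. 1 / 2 * x\<^sup>2) at_top at_top"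
    by (intro filterlim_tendsto_pos_mult_at_top[OF tendsto_const] filterlim_pow_at_top filterlim_ident) auto
  then have "((\<lambda>x::real. 1 / sqrt (2 * pi) * exp (- (1 / 2 * x\<^sup>2))) \<longlongrightarrow> 1 / sqrt (2 * pi) * 0) at_top"
    by (intro tendsto_mult tendsto_const filterlim_compose[OF exp_at_bot]
        filterlim_compose[OF filterlim_uminus_at_bot_at_top])
  then show ?thesis by (simp add: std_normal_density_def[abs_def])
qed

interpretation std_normal: real_distribution std_normal_distribution
  by (rule real_dist_normal_dist)

lemma std_normal_measure_eq_integral:
  assumes "A \<in> sets borel"
  shows "measure std_normal_distribution A = (LINT x:A|lborel. std_normal_density x)"
proof -
  have "emeasure std_normal_distribution A = (\<integral>\<^sup>+ x. ennreal (indicator A x * std_normal_density x) \<partial>lborel)"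
    using assms by (auto simp: emeasure_density intro!: nn_integral_cong split: split_indicator)
  also have "\<dots> = ennreal (LINT x|lborel. indicator A x * std_normal_density x)"
    using integrable_real_mult_indicator[of A lborel std_normal_density] assms
    by (intro nn_integral_eq_integral) (auto simp: mult.commute)
  finally show ?thesis
    by (simp add: measure_def set_lebesgue_integral_def)
qed

lemma std_normal_tail_diff:
  assumes "a \<le> b"
  shows "std_normal_tail a - std_normal_tail b = integral {a..b} std_normal_density"
proof (cases "a = b")
  case False
  have "std_normal_tail a - std_normal_tail b = measure std_normal_distribution {a<..b}"
    using assms False std_normal.cdf_diff_eq[of a b] by (simp add: std_normal_tail_def)
  also have "\<dots> = (LINT x:{a<..b}|lborel. std_normal_density x)"
    by (rule std_normal_measure_eq_integral) simp
  also have "\<dots> = integral {a<..b} std_normal_density"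
    using integrable_real_mult_indicator[of "{a<..b}" lborel std_normal_density]
    by (intro set_borel_integral_eq_integral) (auto simp: set_integrable_def mult.commute)
  also have "\<dots> = integral {a..b} std_normal_density"
    by (rule integral_subset_negligible) (auto intro: negligible_subset[of "{a}"])
  finally show ?thesis .
qed simp

lemma DERIV_std_normal_tail:
  "(std_normal_tail has_real_derivative - std_normal_density x) (at x)"
proof -
  \<comment> \<open>The lower limit \<open>x - 1\<close> stands in for minus infinity; as
    \<open>x\<close> is interior to \<open>{x - 1..x + 1}\<close>, the derivative within this window
    is the full derivative.\<close>
  have "((\<lambda>y. integral {x - 1..y} std_normal_density) has_real_derivative std_normal_density x)
      (at x within {x - 1..x + 1})"
    by (rule integral_has_real_derivative)
       (auto simp: std_normal_density_def intro!: continuous_intros)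
  then have "((\<lambda>y. std_normal_tail (x - 1) - integral {x - 1..y} std_normal_density)
      has_real_derivative - std_normal_density x) (at x within {x - 1..x + 1})"
    by (auto intro!: derivative_eq_intros)
  then have "(std_normal_tail has_real_derivative - std_normal_density x) (at x within {x - 1..x + 1})"
    by (rule has_field_derivative_transform_within[where d = 1])
       (auto simp: std_normal_tail_diff[symmetric])
  then show ?thesis
    using at_within_interior[of x "{x - 1..x + 1}"] by simp
qed

lemma tendsto_std_normal_tail_at_top: "(std_normal_tail \<longlongrightarrow> 0) at_top"
  unfolding std_normal_tail_def[abs_def]
  using tendsto_diff[OF tendsto_const[of 1] std_normal.cdf_lim_at_top_prob] by simp

lemma std_normal_tail_pos: "0 < std_normal_tail x"
  by (rule DERIV_neg_imp_decreasing_at_top[OF _ tendsto_std_normal_tail_at_top])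
     (use DERIV_std_normal_tail std_normal_density_pos in force)

lemma std_normal_tail_le_1: "std_normal_tail x \<le> 1"
  by (simp add: std_normal_tail_def std_normal.cdf_nonneg)

text \<open>The density is even, so the sum of the two tails has derivative 0; its constant value is
  read off at infinity.\<close>

lemma std_normal_tail_minus: "std_normal_tail (- x) = 1 - std_normal_tail x"
proof -
  have even: "std_normal_density (- y) = std_normal_density y" for y
    by (simp add: std_normal_density_def)
  have D: "((\<lambda>x. std_normal_tail x + std_normal_tail (- x)) has_real_derivative 0) (at x)" for x
    using DERIV_add[OF DERIV_std_normal_tail[of x] DERIV_chain2[OF DERIV_std_normal_tail[of "- x"] DERIV_minus[OF DERIV_ident]]]
    by (simp add: even)
  obtain c where c: "std_normal_tail x + std_normal_tail (- x) = c" for x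
    using DERIV_isconst_all[of "\<lambda>x. std_normal_tail x + std_normal_tail (- x)"] D by metis
  have "((\<lambda>x. 1 - cdf std_normal_distribution (-x)) \<longlongrightarrow> 1 - 0) at_top"
    by (intro tendsto_diff tendsto_const filterlim_compose[OF std_normal.cdf_lim_at_bot filterlim_uminus_at_bot_at_top])
  then have "((\<lambda>x. std_normal_tail x + std_normal_tail (-x)) \<longlongrightarrow> 0 + 1) at_top"
    by (intro tendsto_add tendsto_std_normal_tail_at_top) (simp add: std_normal_tail_def)
  then have "c = 1"
    by (simp add: c tendsto_const_iff)
  then show ?thesis
    using c[of x] by simp
qed

text \<open>For positive \<open>x\<close>,
  \<open>std_normal_density x / x - std_normal_tail x\<close> decreases strictly to the limit 0;
  otherwise the left side is nonpositive.\<close>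

lemma mult_std_normal_tail_le: "x * std_normal_tail x \<le> std_normal_density x"
proof (cases "0 < x")
  case True
  have "0 < std_normal_density x / x - std_normal_tail x"
  proof (rule DERIV_neg_imp_decreasing_at_top[where f = "\<lambda>x. std_normal_density x / x - std_normal_tail x"])
    fix y assume "x \<le> y"
    with True have "y > 0" by simp
    then have "((\<lambda>x. std_normal_density x / x - std_normal_tail x) has_real_derivative
        - (std_normal_density y / y\<^sup>2)) (at y)"
      by (auto intro!: derivative_eq_intros DERIV_std_normal_density DERIV_std_normal_tail
          simp: field_simps power2_eq_square)
    moreover have "- (std_normal_density y / y\<^sup>2) < 0"
      using std_normal_density_pos[of y] \<open>y > 0\<close> by simp
    ultimately show "\<exists>z. ((\<lambda>x. std_normal_density x / x - std_normal_tail x) has_real_derivative z) (at y) \<and> z < 0"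
      by metis
  next
    have "((\<lambda>x. std_normal_density x / x - std_normal_tail x) \<longlongrightarrow> 0 - 0) at_top"
      by (intro tendsto_diff tendsto_std_normal_tail_at_top tendsto_divide_0[OF tendsto_std_normal_density_at_top] filterlim_at_top_imp_at_infinity filterlim_ident)
    then show "((\<lambda>x. std_normal_density x / x - std_normal_tail x) \<longlongrightarrow> 0) at_top"
      by simp
  qed
  with True show ?thesis by (simp add: field_simps)
next
  case False
  then have "x * std_normal_tail x \<le> 0"
    using std_normal_tail_pos[of x] by (simp add: mult_nonpos_nonneg)
  also have "0 \<le> std_normal_density x" by simp
  finally show ?thesis .
qed

text \<open>The difference of the two sides has derivative
  \<open>- 2 * std_normal_density y / (1 + y^2)^2\<close> and limit 0 at infinity, whatever the sign
  of \<open>x\<close>. This is what makes \<open>mills_remainder\<close> nonnegative.\<close>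

lemma std_normal_tail_ge: "x * std_normal_density x / (1 + x\<^sup>2) \<le> std_normal_tail x"
proof -
  have nz: "1 + y\<^sup>2 \<noteq> 0" for y :: real
    by (smt (verit) zero_le_power2)
  have "0 < std_normal_tail x - x / (1 + x\<^sup>2) * std_normal_density x"
  proof (rule DERIV_neg_imp_decreasing_at_top[where f = "\<lambda>x. std_normal_tail x - x / (1 + x\<^sup>2) * std_normal_density x"])
    fix y assume "x \<le> y"
    have "((\<lambda>x. x / (1 + x\<^sup>2)) has_real_derivative (1 - y\<^sup>2) / (1 + y\<^sup>2)\<^sup>2) (at y)"
      using nz[of y] by (auto intro!: derivative_eq_intros simp: power2_eq_square)
    from DERIV_diff[OF DERIV_std_normal_tail DERIV_mult[OF this DERIV_std_normal_density]]
    have "((\<lambda>x. std_normal_tail x - x / (1 + x\<^sup>2) * std_normal_density x) has_real_derivative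
        - std_normal_density y - ((1 - y\<^sup>2) / (1 + y\<^sup>2)\<^sup>2 * std_normal_density y
           + - y * std_normal_density y * (y / (1 + y\<^sup>2)))) (at y)" .
    moreover have "- std_normal_density y - ((1 - y\<^sup>2) / (1 + y\<^sup>2)\<^sup>2 * std_normal_density y
           + - y * std_normal_density y * (y / (1 + y\<^sup>2)))
        = - (2 * std_normal_density y / (1 + y\<^sup>2)\<^sup>2)"
    proof -
      \<comment> \<open>Written in \<open>q = 1 + y^2\<close>, so that
        \<open>1 - y^2 = 2 - q\<close> and \<open>y^2 = q - 1\<close>.\<close>
      have *: "1 + ((2 - q) / q\<^sup>2 - (q - 1) / q) = 2 / q\<^sup>2" if "q \<noteq> 0" for q :: real
        using that by (simp add: field_simps power2_eq_square)
      have **: "1 + ((1 - y\<^sup>2) / (1 + y\<^sup>2)\<^sup>2 - y\<^sup>2 / (1 + y\<^sup>2)) = 2 / (1 + y\<^sup>2)\<^sup>2"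
        using *[OF nz[of y]] by simp
      have ***: "- f - (P * f + - y * f * (y / q)) = - f * (1 + (P - y\<^sup>2 / q))" for f P q :: real
        by (simp add: algebra_simps power2_eq_square)
      show ?thesis
        unfolding *** ** by simp
    qed
    moreover have "- (2 * std_normal_density y / (1 + y\<^sup>2)\<^sup>2) < 0"
      using std_normal_density_pos[of y] nz[of y] by simp
    ultimately show "\<exists>z. ((\<lambda>x. std_normal_tail x - x / (1 + x\<^sup>2) * std_normal_density x) has_real_derivative z) (at y) \<and> z < 0"
      by metis
  next
    have "((\<lambda>x::real. x / (1 + x\<^sup>2)) \<longlongrightarrow> 0) at_top"
    proof (rule tendsto_sandwich[OF _ _ tendsto_const tendsto_inverse_0_at_top[OF filterlim_ident]])
      show "\<forall>\<^sub>F x::real in at_top. 0 \<le> x / (1 + x\<^sup>2)"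
        using eventually_ge_at_top[of 0] by eventually_elim (simp add: add_nonneg_nonneg)
      show "\<forall>\<^sub>F x::real in at_top. x / (1 + x\<^sup>2) \<le> inverse x"
        using eventually_gt_at_top[of 0]
      proof eventually_elim
        case (elim x)
        then show ?case
          using divide_left_mono[of "x * x" "1 + x\<^sup>2" x] by (simp add: power2_eq_square add_pos_pos inverse_eq_divide)
      qed
    qed
    then have "((\<lambda>x. std_normal_tail x - x / (1 + x\<^sup>2) * std_normal_density x) \<longlongrightarrow> 0 - 0 * 0) at_top"
      by (intro tendsto_diff tendsto_std_normal_tail_at_top tendsto_mult tendsto_std_normal_density_at_top)
    then show "((\<lambda>x. std_normal_tail x - x / (1 + x\<^sup>2) * std_normal_density x) \<longlongrightarrow> 0) at_top"
      by simp
  qed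
  then show ?thesis by simp
qed

section \<open>Sign, monotonicity and reflection of the Mills ratio\<close>

lemma mult_mills_le_1: "x * mills x \<le> 1"
  using mult_std_normal_tail_le[of x] std_normal_density_pos[of x]
  by (simp add: mills_def field_simps)

lemma mills_remainder_nonneg: "0 \<le> mills_remainder x"
proof -
  have "x / (1 + x\<^sup>2) \<le> mills x"
    using std_normal_tail_ge[of x] std_normal_density_pos[of x]
    by (simp add: mills_def field_simps)
  moreover have "0 < 1 + x\<^sup>2" by (simp add: add_pos_nonneg)
  ultimately show ?thesis
    by (simp add: mills_remainder_def field_simps)
qed

lemma mills_remainder_le_mills:
  assumes "0 \<le> x"
  shows "mills_remainder x \<le> mills x"
  using mult_left_mono[OF mult_mills_le_1[of x] assms]
  by (simp add: mills_remainder_def algebra_simps power2_eq_square)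

lemma DERIV_mills: "(mills has_real_derivative x * mills x - 1) (at x)"
proof -
  have "((\<lambda>x. std_normal_tail x / std_normal_density x) has_real_derivative
     (- std_normal_density x * std_normal_density x - std_normal_tail x * (- x * std_normal_density x))
       / (std_normal_density x * std_normal_density x)) (at x)"
    by (intro DERIV_divide DERIV_std_normal_tail DERIV_std_normal_density)
       (use std_normal_density_pos[of x] in simp)
  moreover have "(- std_normal_density x * std_normal_density x - std_normal_tail x * (- x * std_normal_density x))
       / (std_normal_density x * std_normal_density x) = x * mills x - 1"
    using std_normal_density_pos[of x] by (simp add: mills_def field_simps)
  ultimately show ?thesis by (simp add: mills_def[abs_def])
qed

lemmas DERIV_mills' [derivative_intros] = DERIV_chain2[OF DERIV_mills]

lemma mills_antimono:
  assumes "x \<le> y"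
  shows "mills y \<le> mills x"
proof (rule DERIV_nonpos_imp_nonincreasing[OF assms])
  show "\<exists>z. (mills has_real_derivative z) (at u) \<and> z \<le> 0" for u
    using DERIV_mills[of u] mult_mills_le_1[of u] by force
qed

text \<open>By symmetry \<open>mills x + mills (- x)\<close> is the reciprocal of the density. This
  separates the growth \<open>exp (x^2 / 2)\<close> from a decreasing part.\<close>

lemma mills_minus: "mills (- x) = sqrt (2 * pi) * exp (x\<^sup>2 / 2) - mills x"
proof -
  have "mills (- x) = (1 - std_normal_tail x) / std_normal_density x"
    by (simp add: mills_def std_normal_tail_minus) (simp add: std_normal_density_def)
  then show ?thesis
    unfolding inverse_std_normal_density[symmetric] by (simp add: mills_def diff_divide_distrib)
qed

lemma mills_0: "mills 0 = sqrt (2 * pi) / 2"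
  using mills_minus[of 0] by simp

subsection \<open>Stein's equation for a normal tail\<close>

text \<open>With \<open>g = stein_sol \<tau>\<close>, Stein's equation reads:
  \<open>g' x - x * g x\<close> is \<open>std_normal_tail \<tau>\<close> minus the indicator of
  \<open>\<tau> < x\<close>, off the point \<open>\<tau>\<close>. The branches agree at
  \<open>\<tau>\<close>, where \<open>g\<close> is continuous but has a kink.\<close>

definition stein_sol :: "real \<Rightarrow> real \<Rightarrow> real" where
  "stein_sol \<tau> x = (if x \<le> \<tau> then std_normal_tail \<tau> * mills (- x)
     else (1 - std_normal_tail \<tau>) * mills x)"

definition stein_prod :: "real \<Rightarrow> real \<Rightarrow> real" where
  "stein_prod \<tau> x = x * stein_sol \<tau> x"

text \<open>Replaces \<open>(1 + x^2) * exp (x^2 / 2)\<close> by exponentials, whose expectations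
  under \<open>W\<close> factorise. The summand \<open>1 / 2\<close> is
  \<open>mills 0 / sqrt (2 * pi)\<close> and serves negative arguments; stopping at \<open>J\<close>
  keeps the orders of the exponential moments bounded.\<close>

definition exp_majorant :: "nat \<Rightarrow> real \<Rightarrow> real" where
  "exp_majorant J x = 1 / 2 + exp (1 / 2) *
     (\<Sum>j = 1..J. (1 + (real j)\<^sup>2) * exp (real j * x - (real j)\<^sup>2 / 2))"

text \<open>The mean value inequality with one exceptional point \<open>c\<close>, at which the
  interval is cut. It is applied with \<open>c = \<tau>\<close>, where
  \<open>stein_sol \<tau>\<close> is not differentiable.\<close>

lemma increment_le_of_deriv_le:
  fixes f :: "real \<Rightarrow> real"
  assumes "a \<le> b" and cont: "continuous_on {a..b} f"
    and deriv: "\<And>x. a < x \<Longrightarrow> x < b \<Longrightarrow> x \<noteq> c \<Longrightarrow> \<exists>D. (f has_real_derivative D) (at x) \<and> D \<le> C"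
  shows "f b - f a \<le> C * (b - a)"
proof -
  have smooth: "f v - f u \<le> C * (v - u)" if uv: "a \<le> u" "u \<le> v" "v \<le> b" "v \<le> c \<or> c \<le> u" for u v
  proof (cases "u = v")
    case False
    have diff: "f differentiable at x" if "u < x" "x < v" for x
      using deriv[of x] that uv real_differentiable_def by force
    obtain l z where z: "u < z" "z < v" "(f has_real_derivative l) (at z)" "f v - f u = (v - u) * l"
      using MVT[of u v f] False uv diff continuous_on_subset[OF cont, of "{u..v}"] by auto
    obtain D where "(f has_real_derivative D) (at z)" "D \<le> C"
      using deriv[of z] z uv by force
    with z have "l \<le> C" using DERIV_unique by blast
    with z uv show ?thesis
      by (simp add: mult.commute mult_left_mono)
  qed simp
  show ?thesis
  proof (cases "a < c \<and> c < b")
    case True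
    then show ?thesis
      using smooth[of a c] smooth[of c b] by (simp add: algebra_simps)
  next
    case False
    then show ?thesis
      using smooth[of a b] \<open>a \<le> b\<close> by auto
  qed
qed

section \<open>Continuity, derivatives and monotonicity of the Stein solution\<close>

lemma stein_sol_glue: "std_normal_tail \<tau> * mills (- \<tau>) = (1 - std_normal_tail \<tau>) * mills \<tau>"
  unfolding mills_def std_normal_tail_minus by (simp add: std_normal_density_def)

lemma continuous_on_mills [continuous_intros]:
  "continuous_on S f \<Longrightarrow> continuous_on S (\<lambda>x. mills (f x))"
  by (rule continuous_on_compose2[OF _ _ subset_UNIV])
     (auto intro: DERIV_continuous_on[OF has_field_derivative_at_within[OF DERIV_mills]])

lemma continuous_on_stein_sol: "continuous_on S (stein_sol \<tau>)"
proof -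
  have "continuous_on ({..\<tau>} \<union> {\<tau>..}) (\<lambda>x. if x \<le> \<tau> then std_normal_tail \<tau> * mills (- x)
     else (1 - std_normal_tail \<tau>) * mills x)"
    by (rule continuous_on_If) (auto intro!: continuous_intros simp: antisym stein_sol_glue)
  moreover have "{..\<tau>} \<union> {\<tau>..} = UNIV" by auto
  ultimately have "continuous_on UNIV (stein_sol \<tau>)"
    by (simp add: stein_sol_def[abs_def])
  then show ?thesis
    by (rule continuous_on_subset) simp
qed

lemma continuous_on_stein_prod: "continuous_on S (stein_prod \<tau>)"
  unfolding stein_prod_def[abs_def]
  by (intro continuous_intros continuous_on_stein_sol)

lemma borel_measurable_stein_sol [measurable]: "stein_sol \<tau> \<in> borel_measurable borel"
  by (rule borel_measurable_continuous_onI[OF continuous_on_stein_sol])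

lemma borel_measurable_stein_prod [measurable]: "stein_prod \<tau> \<in> borel_measurable borel"
  by (rule borel_measurable_continuous_onI[OF continuous_on_stein_prod])

lemma stein_sol_less: "x < \<tau> \<Longrightarrow> stein_sol \<tau> x = std_normal_tail \<tau> * mills (- x)"
  and stein_sol_greater: "\<tau> < x \<Longrightarrow> stein_sol \<tau> x = (1 - std_normal_tail \<tau>) * mills x"
  by (simp_all add: stein_sol_def)

lemma DERIV_stein_sol_less:
  assumes "x < \<tau>"
  shows "(stein_sol \<tau> has_real_derivative stein_prod \<tau> x + std_normal_tail \<tau>) (at x)"
proof -
  have "((\<lambda>x. std_normal_tail \<tau> * mills (- x)) has_real_derivative stein_prod \<tau> x + std_normal_tail \<tau>) (at x)"
    using assms by (auto intro!: derivative_eq_intros simp: stein_prod_def stein_sol_less algebra_simps)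
  then show ?thesis
    by (rule has_field_derivative_transform_within_open[of _ _ _ "{..<\<tau>}"])
       (use assms in \<open>auto simp: stein_sol_less\<close>)
qed

lemma DERIV_stein_sol_greater:
  assumes "\<tau> < x"
  shows "(stein_sol \<tau> has_real_derivative stein_prod \<tau> x + std_normal_tail \<tau> - 1) (at x)"
proof -
  have "((\<lambda>x. (1 - std_normal_tail \<tau>) * mills x) has_real_derivative stein_prod \<tau> x + std_normal_tail \<tau> - 1) (at x)"
    using assms by (auto intro!: derivative_eq_intros simp: stein_prod_def stein_sol_greater algebra_simps)
  then show ?thesis
    by (rule has_field_derivative_transform_within_open[of _ _ _ "{\<tau><..}"])
       (use assms in \<open>auto simp: stein_sol_greater\<close>)
qed

lemma DERIV_stein_prod_less:
  assumes "x < \<tau>"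
  shows "(stein_prod \<tau> has_real_derivative std_normal_tail \<tau> * mills_remainder (- x)) (at x)"
proof -
  have "((\<lambda>x. x * stein_sol \<tau> x) has_real_derivative std_normal_tail \<tau> * mills_remainder (- x)) (at x)"
    using DERIV_mult[OF DERIV_ident DERIV_stein_sol_less[OF assms]]
    by (rule DERIV_cong)
       (use assms in \<open>simp add: stein_prod_def stein_sol_less mills_remainder_def algebra_simps power2_eq_square\<close>)
  then show ?thesis by (simp add: stein_prod_def[abs_def])
qed

lemma DERIV_stein_prod_greater:
  assumes "\<tau> < x"
  shows "(stein_prod \<tau> has_real_derivative (1 - std_normal_tail \<tau>) * mills_remainder x) (at x)"
proof -
  have "((\<lambda>x. x * stein_sol \<tau> x) has_real_derivative (1 - std_normal_tail \<tau>) * mills_remainder x) (at x)"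
    using DERIV_mult[OF DERIV_ident DERIV_stein_sol_greater[OF assms]]
    by (rule DERIV_cong)
       (use assms in \<open>simp add: stein_prod_def stein_sol_greater mills_remainder_def algebra_simps power2_eq_square\<close>)
  then show ?thesis by (simp add: stein_prod_def[abs_def])
qed

text \<open>On either side of \<open>\<tau>\<close> the derivative is a nonnegative multiple of a
  value of \<open>mills_remainder\<close>. The increment bound is applied to the negated function
  with \<open>C = 0\<close>.\<close>

lemma stein_prod_mono:
  assumes "x \<le> y"
  shows "stein_prod \<tau> x \<le> stein_prod \<tau> y"
proof -
  have "- stein_prod \<tau> y - - stein_prod \<tau> x \<le> 0 * (y - x)"
  proof (rule increment_le_of_deriv_le[OF assms, where c = \<tau>])
    fix z assume "z \<noteq> \<tau>"
    then consider "z < \<tau>" | "\<tau> < z" by linarith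
    then show "\<exists>D. ((\<lambda>x. - stein_prod \<tau> x) has_real_derivative D) (at z) \<and> D \<le> 0"
    proof cases
      case 1
      then show ?thesis
        using DERIV_minus[OF DERIV_stein_prod_less[OF 1]] std_normal_tail_pos[of \<tau>] mills_remainder_nonneg[of "-z"]
        by (intro exI conjI) auto
    next
      case 2
      then show ?thesis
        using DERIV_minus[OF DERIV_stein_prod_greater[OF 2]] std_normal_tail_le_1[of \<tau>] mills_remainder_nonneg[of z]
        by (intro exI conjI) auto
    qed
  qed (intro continuous_intros continuous_on_stein_prod)
  then show ?thesis by simp
qed

text \<open>
  Stein's kernel at \<open>v + y\<close>, for \<open>y\<close> between \<open>0\<close> and \<open>x\<close>, is compared with the value at
  \<open>v + x'\<close>, where \<open>x'\<close> is an arbitrary point of the support: this stands in for a zero-bias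
  coupling with distance at most \<open>\<beta>\<close>.
\<close>
lemma stein_sol_increment_le:
  assumes "a \<le> 0" "0 \<le> b" "b - a \<le> \<beta>" and x: "x \<in> {a..b}" "x' \<in> {a..b}"
  shows "x * (stein_sol \<tau> (v + x) - stein_sol \<tau> v)
    \<le> x\<^sup>2 * (stein_prod \<tau> (v + x' + \<beta>) + std_normal_tail \<tau> - indicator {\<tau> + \<beta>..} (v + x'))"
    (is "_ \<le> x\<^sup>2 * ?C")
proof -
  have deriv: "\<exists>D. (stein_sol \<tau> has_real_derivative D) (at y) \<and> D \<le> ?C"
    if y: "v + a \<le> y" "y \<le> v + b" "y \<noteq> \<tau>" for y
  proof -
    have G: "stein_prod \<tau> y \<le> stein_prod \<tau> (v + x' + \<beta>)"
      using y x assms by (intro stein_prod_mono) auto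
    consider "y < \<tau>" | "\<tau> < y" using y by linarith
    then show ?thesis
    proof cases
      case 1
      \<comment> \<open>Both \<open>y - v\<close> and \<open>x'\<close> lie in
        \<open>{a..b}\<close>, hence \<open>v + x' \<le> y + (b - a) < \<tau> + \<beta>\<close> and
        the indicator vanishes. The shift by \<open>\<beta>\<close> in the threshold is made for
        this.\<close>
      then have "v + x' \<notin> {\<tau> + \<beta>..}"
        using y x assms by auto
      then show ?thesis
        using DERIV_stein_sol_less[OF 1] G by (intro exI conjI) auto
    next
      \<comment> \<open>Beyond \<open>\<tau>\<close> the derivative already contains
        \<open>- 1\<close>, and the indicator is at most 1.\<close>
      case 2
      then show ?thesis
        using DERIV_stein_sol_greater[OF 2] G by (intro exI conjI) (auto split: split_indicator)
    qed
  qed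
  show ?thesis
  proof (cases "0 \<le> x")
    case True
    have "stein_sol \<tau> (v + x) - stein_sol \<tau> v \<le> ?C * (v + x - v)"
      by (rule increment_le_of_deriv_le[where c = \<tau>])
         (use True x assms in \<open>auto intro!: deriv continuous_on_stein_sol\<close>)
    from mult_left_mono[OF this True] show ?thesis
      by (simp add: power2_eq_square algebra_simps)
  next
    \<comment> \<open>For negative \<open>x\<close> the interval runs from \<open>v + x\<close> to
      \<open>v\<close>; multiplying by \<open>- x\<close> restores the sign.\<close>
    case False
    have "stein_sol \<tau> v - stein_sol \<tau> (v + x) \<le> ?C * (v - (v + x))"
      by (rule increment_le_of_deriv_le[where c = \<tau>])
         (use False x assms in \<open>auto intro!: deriv continuous_on_stein_sol\<close>)
    from mult_left_mono[OF this, of "- x"] False show ?thesis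
      by (simp add: power2_eq_square algebra_simps)
  qed
qed

section \<open>The exponential majorant and the increments of \<open>stein_prod\<close>\<close>

lemma exp_majorant_mono: "x \<le> y \<Longrightarrow> exp_majorant J x \<le> exp_majorant J y"
  unfolding exp_majorant_def
  by (intro add_left_mono mult_left_mono sum_mono) auto

lemma exp_majorant_ge_half: "1 / 2 \<le> exp_majorant J x"
  unfolding exp_majorant_def by (simp add: sum_nonneg)

text \<open>The tangent to \<open>y\<^sup>2 / 2\<close> at an integer within distance 1 of \<open>y\<close> is lower by at most \<open>1 / 2\<close>.\<close>
lemma exp_majorant_ge:
  assumes "1 \<le> j" "j \<le> J" "\<bar>y - real j\<bar> \<le> 1" "y \<le> real j" "0 \<le> y"
  shows "(1 + y\<^sup>2) * exp (y\<^sup>2 / 2) \<le> exp_majorant J y"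
proof -
  have "y\<^sup>2 / 2 \<le> 1 / 2 + (real j * y - (real j)\<^sup>2 / 2)"
    using abs_square_le_1[of "y - real j"] assms by (simp add: power2_eq_square algebra_simps)
  then have "exp (y\<^sup>2 / 2) \<le> exp (1 / 2) * exp (real j * y - (real j)\<^sup>2 / 2)"
    unfolding exp_add[symmetric] by simp
  then have "(1 + y\<^sup>2) * exp (y\<^sup>2 / 2)
      \<le> (1 + (real j)\<^sup>2) * (exp (1 / 2) * exp (real j * y - (real j)\<^sup>2 / 2))"
    using assms by (intro mult_mono) (auto intro: power_mono)
  also have "\<dots> = exp (1 / 2) * ((1 + (real j)\<^sup>2) * exp (real j * y - (real j)\<^sup>2 / 2))"
    by simp
  also have "\<dots> \<le> exp (1 / 2) * (\<Sum>j = 1..J. (1 + (real j)\<^sup>2) * exp (real j * y - (real j)\<^sup>2 / 2))"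
    using assms by (intro mult_left_mono member_le_sum) auto
  finally show ?thesis
    by (simp add: exp_majorant_def)
qed

text \<open>The derivative at each \<open>y \<le> x + \<beta>\<close> is bounded by a multiple of
  the majorant at \<open>y\<close>, and monotonicity of the majorant moves \<open>y\<close> to the
  right endpoint. In all three ranges of \<open>y\<close> the factor
  \<open>std_normal_tail \<tau>\<close> can be taken out.\<close>

lemma stein_prod_increment_le:
  assumes "0 < \<tau>" "0 \<le> \<beta>"
  shows "stein_prod \<tau> (x + \<beta>) - stein_prod \<tau> x
    \<le> std_normal_tail \<tau> * sqrt (2 * pi) * exp_majorant (nat \<lceil>\<tau>\<rceil>) (x + \<beta>) * \<beta>"
proof -
  define J where "J = nat \<lceil>\<tau>\<rceil>"
  have J: "1 \<le> J" "\<tau> \<le> real J" "real J - \<tau> \<le> 1"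
    using assms by (auto simp: J_def) linarith+
  have le: "\<exists>D. (stein_prod \<tau> has_real_derivative D) (at y)
      \<and> D \<le> std_normal_tail \<tau> * sqrt (2 * pi) * exp_majorant J (x + \<beta>)"
    if y: "y \<le> x + \<beta>" "y \<noteq> \<tau>" for y
  proof -
    have mono: "c * exp_majorant J y \<le> c * exp_majorant J (x + \<beta>)" if "0 \<le> c" for c
      using that y by (intro mult_left_mono exp_majorant_mono)
    consider "y < 0" | "0 \<le> y" "y < \<tau>" | "\<tau> < y" using y by linarith
    then have "\<exists>D. (stein_prod \<tau> has_real_derivative D) (at y)
      \<and> D \<le> std_normal_tail \<tau> * (sqrt (2 * pi) * exp_majorant J y)"
    proof cases
      case 1
      have "mills_remainder (- y) \<le> mills 0"
        using mills_remainder_le_mills[of "- y"] mills_antimono[of 0 "- y"] 1 by linarith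
      also have "\<dots> \<le> sqrt (2 * pi) * exp_majorant J y"
        using mult_left_mono[OF exp_majorant_ge_half[of J y], of "sqrt (2 * pi)"] by (simp add: mills_0)
      finally show ?thesis
        using DERIV_stein_prod_less[of y \<tau>] 1 assms std_normal_tail_pos[of \<tau>]
        by (intro exI conjI) auto
    next
      \<comment> \<open>Reflection of the Mills ratio turns \<open>mills_remainder (- y)\<close>
        into the Gaussian growth term minus the nonnegative
        \<open>mills_remainder y\<close>.\<close>
      case 2
      have "mills_remainder (- y) = (1 + y\<^sup>2) * (sqrt (2 * pi) * exp (y\<^sup>2 / 2)) - mills_remainder y"
        by (simp add: mills_remainder_def mills_minus algebra_simps)
      also have "\<dots> \<le> sqrt (2 * pi) * ((1 + y\<^sup>2) * exp (y\<^sup>2 / 2))"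
        using mills_remainder_nonneg[of y] by (simp add: algebra_simps)
      also have "\<dots> \<le> sqrt (2 * pi) * exp_majorant J y"
      proof (intro mult_left_mono)
        show "(1 + y\<^sup>2) * exp (y\<^sup>2 / 2) \<le> exp_majorant J y"
        \<comment> \<open>The index used is the ceiling of \<open>y\<close>. At 0 this would be 0,
          which is outside the sum, so \<open>j = 1\<close> is used there, at distance exactly
          1.\<close>
        proof (cases "y = 0")
          case True
          then show ?thesis using exp_majorant_ge[of 1 J 0] J by simp
        next
          case False
          then show ?thesis
            using 2 assms by (intro exp_majorant_ge[of "nat \<lceil>y\<rceil>"]) (auto simp: J_def; linarith)+
        qed
      qed simp
      finally show ?thesis
        using DERIV_stein_prod_less[of y \<tau>] 2 std_normal_tail_pos[of \<tau>]
        by (intro exI conjI) auto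
    next
      \<comment> \<open>Beyond \<open>\<tau>\<close> the derivative no longer grows: it is at most
        \<open>mills \<tau>\<close>, which is \<open>std_normal_tail \<tau>\<close> over the density
        at \<open>\<tau>\<close>.\<close>
      case 3
      have "(1 - std_normal_tail \<tau>) * mills_remainder y \<le> 1 * mills \<tau>"
        using mills_remainder_le_mills[of y] mills_antimono[of \<tau> y] 3 assms
          std_normal_tail_pos[of \<tau>] std_normal_tail_le_1[of \<tau>] mills_remainder_nonneg[of y]
        by (intro mult_mono) auto
      also have "\<dots> = std_normal_tail \<tau> * (1 / std_normal_density \<tau>)"
        by (simp add: mills_def)
      also have "\<dots> = std_normal_tail \<tau> * (sqrt (2 * pi) * exp (\<tau>\<^sup>2 / 2))"
        by (simp only: inverse_std_normal_density)
      also have "\<dots> \<le> std_normal_tail \<tau> * (sqrt (2 * pi) * exp_majorant J y)"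
      proof (intro mult_left_mono)
        have "exp (\<tau>\<^sup>2 / 2) \<le> (1 + \<tau>\<^sup>2) * exp (\<tau>\<^sup>2 / 2)"
          by (simp add: algebra_simps)
        also have "\<dots> \<le> exp_majorant J \<tau>"
          using J assms by (intro exp_majorant_ge[of J]) auto
        also have "\<dots> \<le> exp_majorant J y"
          using 3 by (intro exp_majorant_mono) simp
        finally show "exp (\<tau>\<^sup>2 / 2) \<le> exp_majorant J y" .
      qed (use std_normal_tail_pos[of \<tau>] in auto)
      finally show ?thesis
        using DERIV_stein_prod_greater[of \<tau> y] 3 by (intro exI conjI) auto
    qed
    moreover have "std_normal_tail \<tau> * (sqrt (2 * pi) * exp_majorant J y)
        \<le> std_normal_tail \<tau> * sqrt (2 * pi) * exp_majorant J (x + \<beta>)"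
      using mono[of "std_normal_tail \<tau> * sqrt (2 * pi)"] std_normal_tail_pos[of \<tau>]
      by (simp add: mult.assoc)
    ultimately show ?thesis
      by (meson order_trans)
  qed
  have "stein_prod \<tau> (x + \<beta>) - stein_prod \<tau> x
      \<le> std_normal_tail \<tau> * sqrt (2 * pi) * exp_majorant J (x + \<beta>) * (x + \<beta> - x)"
    by (rule increment_le_of_deriv_le[where c = \<tau>])
       (use assms in \<open>auto intro!: le continuous_on_stein_prod\<close>)
  then show ?thesis by (simp add: J_def)
qed

subsection \<open>Sums of independent bounded variables\<close>

text \<open>The difference of the two sides and its first derivative vanish at 0, and its second
  derivative is \<open>(1 - exp u * (1 - u)) / 3\<close>, which is nonnegative because
  \<open>1 - u \<le> exp (- u)\<close>.\<close>

lemma exp_le_quadratic_nonneg: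
  fixes u :: real
  assumes "0 \<le> u"
  shows "(1 - u / 3) * (exp u - 1 - u) \<le> u\<^sup>2 / 2"
proof -
  let ?F = "\<lambda>u::real. u\<^sup>2 / 2 - (1 - u / 3) * (exp u - 1 - u)"
  let ?F' = "\<lambda>u::real. u + (exp u - 1 - u) / 3 - (1 - u / 3) * (exp u - 1)"
  let ?F'' = "\<lambda>u::real. 1 / 3 * (1 - exp u * (1 - u))"
  have "?F' 0 \<le> ?F' v" if "0 \<le> v" for v
  proof (rule DERIV_nonneg_imp_nondecreasing[OF that])
    fix x :: real
    have "exp x * (1 - x) \<le> exp x * exp (- x)"
      using exp_ge_add_one_self[of "- x"] by (intro mult_left_mono) auto
    then have "0 \<le> ?F'' x" by (simp add: exp_minus)
    moreover have "(?F' has_real_derivative ?F'' x) (at x)"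
      by (auto intro!: derivative_eq_intros simp: field_simps)
    ultimately show "\<exists>y. (?F' has_real_derivative y) (at x) \<and> 0 \<le> y"
      by blast
  qed
  then have F': "0 \<le> ?F' v" if "0 \<le> v" for v
    using that by fastforce
  have "?F 0 \<le> ?F u"
  proof (rule DERIV_nonneg_imp_nondecreasing[OF assms])
    fix x :: real assume "0 \<le> x"
    moreover have "(?F has_real_derivative ?F' x) (at x)"
      by (auto intro!: derivative_eq_intros simp: field_simps)
    ultimately show "\<exists>y. (?F has_real_derivative y) (at x) \<and> 0 \<le> y"
      using F' by blast
  qed
  then show ?thesis by simp
qed

text \<open>Only an upper bound on \<open>y\<close> enters: for negative \<open>y\<close> the cubic
  Taylor remainder is nonpositive, so \<open>1 + y + y^2 / 2\<close> already suffices.\<close>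

lemma exp_le_quadratic:
  fixes u y :: real
  assumes "y \<le> u" "0 \<le> u" "u < 3"
  shows "exp y \<le> 1 + y + y\<^sup>2 / (2 * (1 - u / 3))"
proof (cases "0 \<le> y")
  case True
  have "exp y - 1 - y \<le> y\<^sup>2 / (2 * (1 - y / 3))"
    using exp_le_quadratic_nonneg[OF True] assms by (simp add: field_simps)
  also have "\<dots> \<le> y\<^sup>2 / (2 * (1 - u / 3))"
    using assms by (intro divide_left_mono) auto
  finally show ?thesis by simp
next
  case False
  have "exp y \<le> 1 + y + y\<^sup>2 / 2"
  proof -
    obtain t where "exp y = (\<Sum>m<3. y ^ m / fact m) + exp t / fact 3 * y ^ 3"
      using Maclaurin_exp_le[of y 3] by blast
    moreover have "exp t / fact 3 * y ^ 3 \<le> 0"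
      using False by (intro mult_nonneg_nonpos) (auto simp: power_le_zero_eq)
    ultimately show ?thesis
      by (simp add: eval_nat_numeral)
  qed
  also have "y\<^sup>2 / 2 \<le> y\<^sup>2 / (2 * (1 - u / 3))"
    using assms by (intro divide_left_mono) auto
  finally show ?thesis by simp
qed

section \<open>Exponential moments and independence\<close>

lemma (in prob_space) integrable_continuous_bounded:
  fixes Z :: "'a \<Rightarrow> real" and f :: "real \<Rightarrow> real"
  assumes [measurable]: "Z \<in> borel_measurable M"
    and B: "\<And>\<omega>. \<omega> \<in> space M \<Longrightarrow> \<bar>Z \<omega>\<bar> \<le> B" and f: "continuous_on UNIV f"
  shows "integrable M (\<lambda>\<omega>. f (Z \<omega>))"
proof -
  have "bounded (f ` {-B..B})"
    by (intro compact_imp_bounded compact_continuous_image continuous_on_subset[OF f]) auto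
  then obtain C where C: "\<And>z. z \<in> {-B..B} \<Longrightarrow> norm (f z) \<le> C"
    unfolding bounded_iff by blast
  have [measurable]: "f \<in> borel_measurable borel"
    using f by (rule borel_measurable_continuous_onI)
  show ?thesis
  proof (rule integrable_const_bound[where B = C])
    show "AE \<omega> in M. norm (f (Z \<omega>)) \<le> C"
      using B by (intro AE_I2 C) (force simp: abs_le_iff)
  qed measurable
qed

text \<open>Take expectations in \<open>exp_le_quadratic\<close> with
  \<open>u = \<theta> * \<beta>\<close>; the linear term has mean 0, and
  \<open>1 + x \<le> exp x\<close> gives a form that multiplies well over independent
  summands.\<close>

lemma (in prob_space) exp_moment_le:
  fixes Z :: "'a \<Rightarrow> real"
  assumes Z [measurable]: "Z \<in> borel_measurable M"
    and B: "\<And>\<omega>. \<omega> \<in> space M \<Longrightarrow> \<bar>Z \<omega>\<bar> \<le> \<beta>"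
    and mean: "expectation Z = 0" and \<theta>: "0 \<le> \<theta>" "\<theta> * \<beta> < 3"
  shows "expectation (\<lambda>\<omega>. exp (\<theta> * Z \<omega>))
    \<le> exp (expectation (\<lambda>\<omega>. (Z \<omega>)\<^sup>2) * (\<theta>\<^sup>2 / (2 * (1 - \<theta> * \<beta> / 3))))"
proof -
  obtain \<omega> where "\<omega> \<in> space M" using not_empty by blast
  then have "0 \<le> \<beta>" using B[of \<omega>] by linarith
  note int = integrable_continuous_bounded[OF Z B]
  have "expectation (\<lambda>\<omega>. exp (\<theta> * Z \<omega>))
      \<le> expectation (\<lambda>\<omega>. 1 + \<theta> * Z \<omega> + (Z \<omega>)\<^sup>2 * (\<theta>\<^sup>2 / (2 * (1 - \<theta> * \<beta> / 3))))"
  proof (rule integral_mono)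
    show "integrable M (\<lambda>\<omega>. exp (\<theta> * Z \<omega>))"
      by (rule int[where f = "\<lambda>z. exp (\<theta> * z)"]) (auto intro!: continuous_intros)
    show "integrable M (\<lambda>\<omega>. 1 + \<theta> * Z \<omega> + (Z \<omega>)\<^sup>2 * (\<theta>\<^sup>2 / (2 * (1 - \<theta> * \<beta> / 3))))"
      by (rule int[where f = "\<lambda>z. 1 + \<theta> * z + z\<^sup>2 * (\<theta>\<^sup>2 / (2 * (1 - \<theta> * \<beta> / 3)))"])
         (use \<theta> in \<open>auto intro!: continuous_intros simp: mult.commute\<close>)
    fix \<omega> assume "\<omega> \<in> space M"
    then have "\<theta> * Z \<omega> \<le> \<theta> * \<beta>"
      using B[of \<omega>] \<theta> by (intro mult_left_mono) auto
    from exp_le_quadratic[OF this] \<theta> \<open>0 \<le> \<beta>\<close>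
    show "exp (\<theta> * Z \<omega>) \<le> 1 + \<theta> * Z \<omega> + (Z \<omega>)\<^sup>2 * (\<theta>\<^sup>2 / (2 * (1 - \<theta> * \<beta> / 3)))"
      by (simp add: power_mult_distrib mult.commute)
  qed
  also have "\<dots> = 1 + expectation (\<lambda>\<omega>. (Z \<omega>)\<^sup>2) * (\<theta>\<^sup>2 / (2 * (1 - \<theta> * \<beta> / 3)))"
    using int[of "\<lambda>z. z\<^sup>2"] int[of "\<lambda>z. z"] mean
    by (simp add: continuous_on_power prob_space)
  also have "\<dots> \<le> exp (expectation (\<lambda>\<omega>. (Z \<omega>)\<^sup>2) * (\<theta>\<^sup>2 / (2 * (1 - \<theta> * \<beta> / 3))))"
    by (rule exp_ge_add_one_self)
  finally show ?thesis .
qed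

text \<open>Fubini for the joint law of \<open>X\<close> and \<open>V\<close>, pulled back to
  \<open>M\<close>: the outer point \<open>\<omega>'\<close> fixes \<open>V\<close> while the inner
  expectation averages over an independent copy of \<open>X\<close>.\<close>

lemma (in prob_space) indep_var_iterated_integral:
  fixes h :: "real \<times> real \<Rightarrow> real"
  assumes indep: "indep_var borel X borel V"
    and [measurable]: "h \<in> borel_measurable (borel \<Otimes>\<^sub>M borel)"
    and int: "integrable M (\<lambda>\<omega>. h (X \<omega>, V \<omega>))"
  shows "integrable M (\<lambda>\<omega>'. expectation (\<lambda>\<omega>. h (X \<omega>, V \<omega>')))" (is ?int)
    and "expectation (\<lambda>\<omega>. h (X \<omega>, V \<omega>))
      = expectation (\<lambda>\<omega>'. expectation (\<lambda>\<omega>. h (X \<omega>, V \<omega>')))" (is ?eq)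
proof -
  have [measurable]: "random_variable borel X" "random_variable borel V"
    and distr: "distr M borel X \<Otimes>\<^sub>M distr M borel V = distr M (borel \<Otimes>\<^sub>M borel) (\<lambda>\<omega>. (X \<omega>, V \<omega>))"
    using indep by (auto simp: indep_var_distribution_eq)
  interpret X: prob_space "distr M borel X" by (rule prob_space_distr) measurable
  interpret V: prob_space "distr M borel V" by (rule prob_space_distr) measurable
  interpret P: pair_prob_space "distr M borel X" "distr M borel V" ..
  have joint: "integrable (distr M borel X \<Otimes>\<^sub>M distr M borel V) (\<lambda>(x, v). h (x, v))"
    unfolding distr using int by (simp add: integrable_distr_eq)
  have inner: "(\<integral>x. h (x, v) \<partial>distr M borel X) = expectation (\<lambda>\<omega>. h (X \<omega>, v))" for v
    by (rule integral_distr) measurable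
  show ?int
    using P.integrable_snd[OF joint] unfolding inner by (subst (asm) integrable_distr_eq) simp_all
  have "expectation (\<lambda>\<omega>. h (X \<omega>, V \<omega>)) = integral\<^sup>L (distr M borel X \<Otimes>\<^sub>M distr M borel V) h"
    unfolding distr by (simp add: integral_distr)
  also have "\<dots> = (\<integral>v. (\<integral>x. h (x, v) \<partial>distr M borel X) \<partial>distr M borel V)"
    using P.integral_snd[OF joint] by simp
  also have "\<dots> = expectation (\<lambda>\<omega>'. expectation (\<lambda>\<omega>. h (X \<omega>, V \<omega>')))"
    unfolding inner by (subst integral_distr) simp_all
  finally show ?eq .
qed

text \<open>The support condition is imposed at every point of the space, so that continuous
  functions of \<open>W\<close> are bounded and hence integrable without further argument.\<close>

locale bounded_indep_sum = prob_space M for M :: "'a measure" +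
  fixes I :: "'i set" and X :: "'i \<Rightarrow> 'a \<Rightarrow> real" and a b :: "'i \<Rightarrow> real" and \<beta> :: real
  assumes finite_I: "finite I"
    and indep: "indep_vars (\<lambda>_. borel) X I"
    and X_mem: "\<And>i \<omega>. i \<in> I \<Longrightarrow> \<omega> \<in> space M \<Longrightarrow> X i \<omega> \<in> {a i..b i}"
    and a_le_0: "\<And>i. i \<in> I \<Longrightarrow> a i \<le> 0" and b_ge_0: "\<And>i. i \<in> I \<Longrightarrow> 0 \<le> b i"
    and width: "\<And>i. i \<in> I \<Longrightarrow> b i - a i \<le> \<beta>"
    and mean_X: "\<And>i. i \<in> I \<Longrightarrow> expectation (X i) = 0"
    and var_X: "(\<Sum>i\<in>I. expectation (\<lambda>\<omega>. (X i \<omega>)\<^sup>2)) = 1"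
begin

definition W :: "'a \<Rightarrow> real" where "W \<omega> = (\<Sum>i\<in>I. X i \<omega>)"

lemma X_measurable [measurable (raw)]: "i \<in> I \<Longrightarrow> X i \<in> borel_measurable M"
  using indep by (simp add: indep_vars_def)

lemma W_measurable [measurable]: "W \<in> borel_measurable M"
  unfolding W_def[abs_def] by measurable

lemma X_abs_le: "i \<in> I \<Longrightarrow> \<omega> \<in> space M \<Longrightarrow> \<bar>X i \<omega>\<bar> \<le> \<beta>"
  using X_mem[of i \<omega>] a_le_0[of i] b_ge_0[of i] width[of i] by auto

lemma sum_X_abs_le:
  assumes "J \<subseteq> I" "\<omega> \<in> space M"
  shows "\<bar>\<Sum>i\<in>J. X i \<omega>\<bar> \<le> real (card J) * \<beta>"
  using sum_norm_bound[of J "\<lambda>i. X i \<omega>" \<beta>] X_abs_le assms by auto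

lemma W_abs_le: "\<omega> \<in> space M \<Longrightarrow> \<bar>W \<omega>\<bar> \<le> real (card I) * \<beta>"
  unfolding W_def by (rule sum_X_abs_le) simp

lemmas integrable_W = integrable_continuous_bounded[OF W_measurable W_abs_le]

lemma \<beta>_nonneg: "0 \<le> \<beta>"
proof -
  \<comment> \<open>An empty index set would have total variance 0.\<close>
  obtain i where "i \<in> I" using var_X by fastforce
  then show ?thesis using a_le_0[of i] b_ge_0[of i] width[of i] by linarith
qed

lemma exp_moment_W_le:
  assumes "0 \<le> \<theta>" "\<theta> * \<beta> < 3"
  shows "expectation (\<lambda>\<omega>. exp (\<theta> * W \<omega>)) \<le> exp (\<theta>\<^sup>2 / (2 * (1 - \<theta> * \<beta> / 3)))"
proof -
  have "expectation (\<lambda>\<omega>. exp (\<theta> * W \<omega>)) = expectation (\<lambda>\<omega>. \<Prod>i\<in>I. exp (\<theta> * X i \<omega>))"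
    by (simp add: W_def sum_distrib_left exp_sum finite_I)
  also have "\<dots> = (\<Prod>i\<in>I. expectation (\<lambda>\<omega>. exp (\<theta> * X i \<omega>)))"
  proof (rule indep_vars_lebesgue_integral[OF finite_I])
    show "indep_vars (\<lambda>_. borel) (\<lambda>i \<omega>. exp (\<theta> * X i \<omega>)) I"
      by (rule indep_vars_compose2[OF indep, where Y = "\<lambda>_ x. exp (\<theta> * x)"]) simp
    show "integrable M (\<lambda>\<omega>. exp (\<theta> * X i \<omega>))" if "i \<in> I" for i
      by (rule integrable_continuous_bounded[OF X_measurable[OF that] X_abs_le[OF that], where f = "\<lambda>z. exp (\<theta> * z)"])
         (auto intro!: continuous_intros)
  qed
  also have "\<dots> \<le> (\<Prod>i\<in>I. exp (expectation (\<lambda>\<omega>. (X i \<omega>)\<^sup>2) * (\<theta>\<^sup>2 / (2 * (1 - \<theta> * \<beta> / 3)))))"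
    by (intro prod_mono conjI exp_moment_le Bochner_Integration.integral_nonneg X_measurable X_abs_le mean_X assms) auto
  also have "\<dots> = exp ((\<Sum>i\<in>I. expectation (\<lambda>\<omega>. (X i \<omega>)\<^sup>2)) * (\<theta>\<^sup>2 / (2 * (1 - \<theta> * \<beta> / 3))))"
    by (simp only: exp_sum[OF finite_I, symmetric] sum_distrib_right)
  finally show ?thesis by (simp add: var_X)
qed

lemma bernstein:
  assumes "0 \<le> t"
  shows "prob {\<omega> \<in> space M. t \<le> W \<omega>} \<le> exp (- (t\<^sup>2 / (2 * (1 + \<beta> * t / 3))))"
proof -
  define q where "q = \<beta> * t / 3"
  have q: "0 \<le> q" using assms \<beta>_nonneg by (simp add: q_def)
  \<comment> \<open>This choice makes \<open>1 - \<theta> * \<beta> / 3\<close> equal to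
    \<open>1 / (1 + q)\<close>, and the Chernoff exponent becomes
    \<open>t^2 / (2 * (1 + q)) - t^2 / (1 + q)\<close>.\<close>
  define \<theta> where "\<theta> = t / (1 + q)"
  have \<theta>: "0 \<le> \<theta>" "\<theta> * \<beta> < 3" "1 - \<theta> * \<beta> / 3 = 1 / (1 + q)"
    using assms q by (auto simp: \<theta>_def q_def field_simps)
  have "prob {\<omega> \<in> space M. t \<le> W \<omega>} \<le> prob {\<omega> \<in> space M. exp (\<theta> * t) \<le> exp (\<theta> * W \<omega>)}"
    by (intro finite_measure_mono) (auto intro: mult_left_mono \<theta>)
  also have "\<dots> \<le> expectation (\<lambda>\<omega>. exp (\<theta> * W \<omega>)) / exp (\<theta> * t)"
    by (intro integral_Markov_inequality_measure[where A = "{}"] integrable_W[where f = "\<lambda>w. exp (\<theta> * w)"])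
       (auto intro!: continuous_intros)
  also have "\<dots> \<le> exp (\<theta>\<^sup>2 / (2 * (1 - \<theta> * \<beta> / 3))) / exp (\<theta> * t)"
    by (intro divide_right_mono exp_moment_W_le \<theta>) auto
  also have "\<dots> = exp (\<theta>\<^sup>2 / (2 * (1 - \<theta> * \<beta> / 3)) - \<theta> * t)"
    by (simp add: exp_diff)
  also have "\<theta>\<^sup>2 / (2 * (1 - \<theta> * \<beta> / 3)) - \<theta> * t = - (t\<^sup>2 / (2 * (1 + q)))"
  proof -
    have "(t / p)\<^sup>2 / (2 * (1 / p)) - t / p * t = - (t\<^sup>2 / (2 * p))" if "0 < p" for p
      using that by (simp add: field_simps power2_eq_square)
    from this[of "1 + q"] show ?thesis
      unfolding \<theta>(3) using q by (simp add: \<theta>_def)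
  qed
  finally show ?thesis by (simp add: q_def)
qed

text \<open>Write \<open>W = V + X i\<close> with \<open>V\<close> independent of the centred
  \<open>X i\<close>. Then \<open>g (V)\<close> can be subtracted from \<open>g (W)\<close> for
  free, and \<open>stein_sol_increment_le\<close> applies with \<open>x'\<close> an independent copy
  of \<open>X i\<close>: the factor \<open>x^2\<close> integrates to the variance, and
  \<open>V + x'\<close> has the law of \<open>W\<close>.\<close>

lemma stein_term_le:
  assumes i: "i \<in> I"
  shows "expectation (\<lambda>\<omega>. X i \<omega> * stein_sol \<tau> (W \<omega>))
    \<le> expectation (\<lambda>\<omega>. (X i \<omega>)\<^sup>2) * expectation (\<lambda>\<omega>. stein_prod \<tau> (W \<omega> + \<beta>)
        + std_normal_tail \<tau> - indicator {\<tau> + \<beta>..} (W \<omega>))"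
proof -
  define g where "g = stein_sol \<tau>"
  define \<Psi> where "\<Psi> w = stein_prod \<tau> (w + \<beta>) + std_normal_tail \<tau> - indicator {\<tau> + \<beta>..} w" for w
  define V where "V \<omega> = (\<Sum>j\<in>I - {i}. X j \<omega>)" for \<omega>
  have [measurable]: "g \<in> borel_measurable borel" "\<Psi> \<in> borel_measurable borel"
    unfolding g_def \<Psi>_def[abs_def] by measurable
  have [measurable]: "X i \<in> borel_measurable M" "V \<in> borel_measurable M"
    unfolding V_def[abs_def] using i by auto
  have W_eq: "W \<omega> = V \<omega> + X i \<omega>" for \<omega>
    unfolding W_def V_def using sum.remove[OF finite_I i] by (simp add: add.commute)
  have indep_XV: "indep_var borel (X i) borel V"
    unfolding V_def[abs_def]
    by (rule indep_vars_sum) (use finite_I i indep in \<open>auto simp: insert_absorb\<close>)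
  have V_le: "\<bar>V \<omega>\<bar> \<le> real (card (I - {i})) * \<beta>" if "\<omega> \<in> space M" for \<omega>
    unfolding V_def by (rule sum_X_abs_le) (use that in auto)
  have g_cont: "continuous_on S (\<lambda>x. g (f x))" if "continuous_on S f" for f :: "real \<Rightarrow> real" and S
    unfolding g_def by (rule continuous_on_compose2[OF continuous_on_stein_sol that subset_UNIV])
  have G_cont: "continuous_on S (\<lambda>x. stein_prod \<tau> (f x))" if "continuous_on S f" for f :: "real \<Rightarrow> real" and S
    by (rule continuous_on_compose2[OF continuous_on_stein_prod that subset_UNIV])
  note int_X = integrable_continuous_bounded[OF X_measurable[OF i] X_abs_le[OF i]]
  have int_g [simp]: "integrable M (\<lambda>\<omega>. g (V \<omega>))"
    by (rule integrable_continuous_bounded[OF _ V_le]) (auto intro: g_cont)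
  have int_Xg [simp]: "integrable M (\<lambda>\<omega>. X i \<omega> * f (Z \<omega>))"
    if "continuous_on UNIV f" "Z \<in> borel_measurable M" "\<And>\<omega>. \<omega> \<in> space M \<Longrightarrow> \<bar>Z \<omega>\<bar> \<le> B"
    for f :: "real \<Rightarrow> real" and Z B
  proof (rule Bochner_Integration.integrable_bound)
    have [measurable]: "f \<in> borel_measurable borel"
      using that(1) by (rule borel_measurable_continuous_onI)
    show "(\<lambda>\<omega>. X i \<omega> * f (Z \<omega>)) \<in> borel_measurable M"
      using that(2) by measurable
    show "integrable M (\<lambda>\<omega>. \<beta> * f (Z \<omega>))"
      by (intro integrable_mult_right integrable_continuous_bounded[OF that(2,3,1)])
    show "AE \<omega> in M. norm (X i \<omega> * f (Z \<omega>)) \<le> norm (\<beta> * f (Z \<omega>))"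
      using X_abs_le[OF i] \<beta>_nonneg by (intro AE_I2) (auto simp: abs_mult intro!: mult_right_mono)
  qed
  have XgW: "integrable M (\<lambda>\<omega>. X i \<omega> * g (W \<omega>))" and XgV: "integrable M (\<lambda>\<omega>. X i \<omega> * g (V \<omega>))"
    by (rule int_Xg[OF _ _ W_abs_le] int_Xg[OF _ _ V_le]; auto intro: g_cont)+
  have int_\<Psi>X: "integrable M (\<lambda>\<omega>. \<Psi> (v + X i \<omega>))" for v
    unfolding \<Psi>_def
    by (intro Bochner_Integration.integrable_diff Bochner_Integration.integrable_add
          int_X[where f = "\<lambda>x. stein_prod \<tau> (v + x + \<beta>)"] integrable_const_bound[where B = 1])
       (auto intro!: G_cont continuous_intros simp: indicator_def abs_of_pos std_normal_tail_pos std_normal_tail_le_1)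
  have int_\<Psi>W: "integrable M (\<lambda>\<omega>. \<Psi> (V \<omega> + X i \<omega>))"
    unfolding \<Psi>_def W_eq[symmetric]
    by (intro Bochner_Integration.integrable_diff Bochner_Integration.integrable_add
          integrable_W[where f = "\<lambda>x. stein_prod \<tau> (x + \<beta>)"] integrable_const_bound[where B = 1])
       (auto intro!: G_cont continuous_intros simp: indicator_def abs_of_pos std_normal_tail_pos std_normal_tail_le_1)
  define h where "h = (\<lambda>(x, v). x * (g (v + x) - g v))"
  have [measurable]: "h \<in> borel_measurable (borel \<Otimes>\<^sub>M borel)"
    unfolding h_def by measurable
  have int_h: "integrable M (\<lambda>\<omega>. h (X i \<omega>, V \<omega>))"
    using Bochner_Integration.integrable_diff[OF XgW XgV] by (simp add: h_def W_eq algebra_simps)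
  have "expectation (\<lambda>\<omega>. X i \<omega> * g (V \<omega>)) = expectation (X i) * expectation (\<lambda>\<omega>. g (V \<omega>))"
  proof (rule indep_var_lebesgue_integral)
    have "indep_var borel (id \<circ> X i) borel (g \<circ> V)"
      by (rule indep_var_compose[OF indep_XV]) auto
    then show "indep_var borel (X i) borel (\<lambda>\<omega>. g (V \<omega>))"
      by (simp add: comp_def)
    show "integrable M (X i)"
      using int_X[of "\<lambda>x. x"] by simp
  qed simp
  then have "expectation (\<lambda>\<omega>. X i \<omega> * g (V \<omega>)) = 0"
    using mean_X[OF i] by simp
  then have "expectation (\<lambda>\<omega>. X i \<omega> * g (W \<omega>)) = expectation (\<lambda>\<omega>. h (X i \<omega>, V \<omega>))"
    using Bochner_Integration.integral_diff[OF XgW XgV] by (simp add: h_def W_eq algebra_simps)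
  also have "\<dots> = expectation (\<lambda>\<omega>'. expectation (\<lambda>\<omega>. h (X i \<omega>, V \<omega>')))"
    by (rule indep_var_iterated_integral(2)[OF indep_XV _ int_h]) measurable
  also have "\<dots> \<le> expectation (\<lambda>\<omega>'. expectation (\<lambda>\<omega>. (X i \<omega>)\<^sup>2) * expectation (\<lambda>\<omega>. \<Psi> (V \<omega>' + X i \<omega>)))"
  proof (rule integral_mono)
    show "integrable M (\<lambda>\<omega>'. expectation (\<lambda>\<omega>. h (X i \<omega>, V \<omega>')))"
      by (rule indep_var_iterated_integral(1)[OF indep_XV _ int_h]) measurable
    show "integrable M (\<lambda>\<omega>'. expectation (\<lambda>\<omega>. (X i \<omega>)\<^sup>2) * expectation (\<lambda>\<omega>. \<Psi> (V \<omega>' + X i \<omega>)))"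
      using indep_var_iterated_integral(1)[OF indep_XV, of "\<lambda>(x, v). \<Psi> (v + x)"] int_\<Psi>W by simp
    fix \<omega>' assume "\<omega>' \<in> space M"
    define v where "v = V \<omega>'"
    \<comment> \<open>With \<open>V\<close> frozen at \<open>v\<close>, the free point
      \<open>x'\<close> is \<open>X i \<omega>2\<close> for a second sample point
      \<open>\<omega>2\<close>, over which the bound is averaged afterwards.\<close>
    have "expectation (\<lambda>\<omega>. h (X i \<omega>, v)) \<le> expectation (\<lambda>\<omega>. (X i \<omega>)\<^sup>2) * \<Psi> (v + X i \<omega>2)"
      if "\<omega>2 \<in> space M" for \<omega>2
    proof -
      have "expectation (\<lambda>\<omega>. h (X i \<omega>, v)) \<le> expectation (\<lambda>\<omega>. (X i \<omega>)\<^sup>2 * \<Psi> (v + X i \<omega>2))"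
      proof (rule integral_mono)
        show "integrable M (\<lambda>\<omega>. h (X i \<omega>, v))"
          unfolding h_def prod.case
          by (rule int_X[where f = "\<lambda>x. x * (g (v + x) - g v)"]) (auto intro!: continuous_intros g_cont)
        show "integrable M (\<lambda>\<omega>. (X i \<omega>)\<^sup>2 * \<Psi> (v + X i \<omega>2))"
          by (rule int_X[where f = "\<lambda>x. x\<^sup>2 * \<Psi> (v + X i \<omega>2)"]) (auto intro!: continuous_intros)
        show "h (X i \<omega>, v) \<le> (X i \<omega>)\<^sup>2 * \<Psi> (v + X i \<omega>2)" if "\<omega> \<in> space M" for \<omega>
          using stein_sol_increment_le[OF a_le_0[OF i] b_ge_0[OF i] width[OF i]
              X_mem[OF i that] X_mem[OF i \<open>\<omega>2 \<in> space M\<close>]]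
          by (simp add: h_def g_def \<Psi>_def)
      qed
      then show ?thesis by simp
    qed
    then have "expectation (\<lambda>_. expectation (\<lambda>\<omega>. h (X i \<omega>, v)))
        \<le> expectation (\<lambda>\<omega>2. expectation (\<lambda>\<omega>. (X i \<omega>)\<^sup>2) * \<Psi> (v + X i \<omega>2))"
      using int_\<Psi>X by (intro integral_mono) auto
    then show "expectation (\<lambda>\<omega>. h (X i \<omega>, V \<omega>'))
        \<le> expectation (\<lambda>\<omega>. (X i \<omega>)\<^sup>2) * expectation (\<lambda>\<omega>. \<Psi> (V \<omega>' + X i \<omega>))"
      by (simp add: v_def prob_space)
  qed
  also have "\<dots> = expectation (\<lambda>\<omega>. (X i \<omega>)\<^sup>2) * expectation (\<lambda>\<omega>. \<Psi> (W \<omega>))"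
    using indep_var_iterated_integral(2)[OF indep_XV, of "\<lambda>(x, v). \<Psi> (v + x)"] int_\<Psi>W
    by (simp add: W_eq)
  finally show ?thesis by (simp add: g_def \<Psi>_def)
qed

text \<open>Summing \<open>stein_term_le\<close> over \<open>I\<close> gives the expectation of
  \<open>stein_prod \<tau> (W \<omega>)\<close> on the left and, as the variances add up to 1, a
  single expectation on the right. The indicator in it contributes the probability in
  question.\<close>

lemma prob_le_stein:
  "prob {\<omega> \<in> space M. \<tau> + \<beta> \<le> W \<omega>} \<le> std_normal_tail \<tau>
    + expectation (\<lambda>\<omega>. stein_prod \<tau> (W \<omega> + \<beta>) - stein_prod \<tau> (W \<omega>))"
proof -
  have G_cont: "continuous_on S (\<lambda>x. stein_prod \<tau> (f x))" if "continuous_on S f" for f :: "real \<Rightarrow> real" and S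
    by (rule continuous_on_compose2[OF continuous_on_stein_prod that subset_UNIV])
  have int: "integrable M (\<lambda>\<omega>. stein_prod \<tau> (W \<omega> + c))" for c
    by (rule integrable_W[where f = "\<lambda>x. stein_prod \<tau> (x + c)"]) (auto intro!: G_cont continuous_intros)
  have set: "{\<omega> \<in> space M. \<tau> + \<beta> \<le> W \<omega>} \<in> events" by measurable
  have int_X: "integrable M (\<lambda>\<omega>. X i \<omega> * stein_sol \<tau> (W \<omega>))" if "i \<in> I" for i
  proof (rule Bochner_Integration.integrable_bound)
    show "integrable M (\<lambda>\<omega>. \<beta> * stein_sol \<tau> (W \<omega>))"
      by (intro integrable_mult_right integrable_W continuous_on_stein_sol)
    show "AE \<omega> in M. norm (X i \<omega> * stein_sol \<tau> (W \<omega>)) \<le> norm (\<beta> * stein_sol \<tau> (W \<omega>))"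
      using X_abs_le[OF that] \<beta>_nonneg by (intro AE_I2) (auto simp: abs_mult intro!: mult_right_mono)
  qed (use that in measurable)
  have "expectation (\<lambda>\<omega>. stein_prod \<tau> (W \<omega>)) = expectation (\<lambda>\<omega>. \<Sum>i\<in>I. X i \<omega> * stein_sol \<tau> (W \<omega>))"
    by (simp add: stein_prod_def W_def sum_distrib_right)
  also have "\<dots> = (\<Sum>i\<in>I. expectation (\<lambda>\<omega>. X i \<omega> * stein_sol \<tau> (W \<omega>)))"
    by (rule Bochner_Integration.integral_sum) (rule int_X)
  also have "\<dots> \<le> (\<Sum>i\<in>I. expectation (\<lambda>\<omega>. (X i \<omega>)\<^sup>2) * expectation (\<lambda>\<omega>. stein_prod \<tau> (W \<omega> + \<beta>)
        + std_normal_tail \<tau> - indicator {\<tau> + \<beta>..} (W \<omega>)))"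
    by (intro sum_mono stein_term_le)
  also have "\<dots> = expectation (\<lambda>\<omega>. stein_prod \<tau> (W \<omega> + \<beta>)
        + std_normal_tail \<tau> - indicator {\<tau> + \<beta>..} (W \<omega>))"
    by (simp add: sum_distrib_right[symmetric] var_X)
  also have "\<dots> = expectation (\<lambda>\<omega>. stein_prod \<tau> (W \<omega> + \<beta>)
        + std_normal_tail \<tau> - indicator {\<omega> \<in> space M. \<tau> + \<beta> \<le> W \<omega>} \<omega>)"
    by (intro Bochner_Integration.integral_cong) (auto simp: indicator_def)
  also have "\<dots> = expectation (\<lambda>\<omega>. stein_prod \<tau> (W \<omega> + \<beta>)) + std_normal_tail \<tau>
      - prob {\<omega> \<in> space M. \<tau> + \<beta> \<le> W \<omega>}"
    using int[of \<beta>] set by (simp add: prob_space emeasure_eq_measure)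
  finally show ?thesis
    using int[of \<beta>] int[of 0] by simp
qed

text \<open>The tangent term \<open>- j^2 / 2\<close> cancels the leading part of the exponential
  moment bound, so that for small \<open>j^3 * \<beta>\<close> the \<open>j\<close>-th summand is of
  order \<open>1 + j^2\<close>.\<close>

lemma expectation_exp_majorant_le:
  assumes "real J * \<beta> < 3"
  shows "expectation (\<lambda>\<omega>. exp_majorant J (W \<omega> + \<beta>)) \<le> 1 / 2 + exp (1 / 2) *
    (\<Sum>j = 1..J. (1 + (real j)\<^sup>2)
      * exp (real j * \<beta> - (real j)\<^sup>2 / 2 + (real j)\<^sup>2 / (2 * (1 - real j * \<beta> / 3))))"
proof -
  have int: "integrable M (\<lambda>\<omega>. exp (\<theta> * W \<omega>))" for \<theta>
    by (rule integrable_W[where f = "\<lambda>w. exp (\<theta> * w)"]) (auto intro!: continuous_intros)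
  have split: "exp (real j * (W \<omega> + \<beta>) - (real j)\<^sup>2 / 2)
      = exp (real j * \<beta> - (real j)\<^sup>2 / 2) * exp (real j * W \<omega>)" for j \<omega>
    unfolding exp_add[symmetric] by (simp add: algebra_simps)
  have "expectation (\<lambda>\<omega>. exp_majorant J (W \<omega> + \<beta>)) = 1 / 2 + exp (1 / 2) *
    (\<Sum>j = 1..J. (1 + (real j)\<^sup>2) * (exp (real j * \<beta> - (real j)\<^sup>2 / 2)
       * expectation (\<lambda>\<omega>. exp (real j * W \<omega>))))"
    unfolding exp_majorant_def split
    using int by (simp add: prob_space)
  also have "\<dots> \<le> 1 / 2 + exp (1 / 2) *
    (\<Sum>j = 1..J. (1 + (real j)\<^sup>2) * (exp (real j * \<beta> - (real j)\<^sup>2 / 2)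
       * exp ((real j)\<^sup>2 / (2 * (1 - real j * \<beta> / 3)))))"
  proof (intro add_left_mono mult_left_mono sum_mono exp_moment_W_le)
    fix j assume "j \<in> {1..J}"
    then have "real j * \<beta> \<le> real J * \<beta>"
      using \<beta>_nonneg by (intro mult_right_mono) auto
    then show "real j * \<beta> < 3" using assms by simp
  qed auto
  finally show ?thesis
    by (simp add: exp_add)
qed

lemma prob_le_tail_mult:
  assumes "0 < \<tau>" "real (nat \<lceil>\<tau>\<rceil>) * \<beta> < 3"
  shows "prob {\<omega> \<in> space M. \<tau> + \<beta> \<le> W \<omega>} \<le> std_normal_tail \<tau> *
    (1 + \<beta> * sqrt (2 * pi) * (1 / 2 + exp (1 / 2) *
    (\<Sum>j = 1..nat \<lceil>\<tau>\<rceil>. (1 + (real j)\<^sup>2)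
      * exp (real j * \<beta> - (real j)\<^sup>2 / 2 + (real j)\<^sup>2 / (2 * (1 - real j * \<beta> / 3))))))"
    (is "_ \<le> _ * (1 + _ * ?S)")
proof -
  have G_cont: "continuous_on S (\<lambda>x. stein_prod \<tau> (f x))" if "continuous_on S f" for f :: "real \<Rightarrow> real" and S
    by (rule continuous_on_compose2[OF continuous_on_stein_prod that subset_UNIV])
  have "expectation (\<lambda>\<omega>. stein_prod \<tau> (W \<omega> + \<beta>) - stein_prod \<tau> (W \<omega>))
      \<le> expectation (\<lambda>\<omega>. std_normal_tail \<tau> * sqrt (2 * pi) * exp_majorant (nat \<lceil>\<tau>\<rceil>) (W \<omega> + \<beta>) * \<beta>)"
    using assms \<beta>_nonneg
    by (intro integral_mono stein_prod_increment_le
          integrable_W[where f = "\<lambda>x. stein_prod \<tau> (x + \<beta>) - stein_prod \<tau> x"]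
          integrable_W[where f = "\<lambda>x. std_normal_tail \<tau> * sqrt (2 * pi) * exp_majorant (nat \<lceil>\<tau>\<rceil>) (x + \<beta>) * \<beta>"])
       (auto intro!: G_cont continuous_intros simp: exp_majorant_def)
  also have "\<dots> = std_normal_tail \<tau> * (\<beta> * sqrt (2 * pi) * expectation (\<lambda>\<omega>. exp_majorant (nat \<lceil>\<tau>\<rceil>) (W \<omega> + \<beta>)))"
    by simp
  also have "\<dots> \<le> std_normal_tail \<tau> * (\<beta> * sqrt (2 * pi) * ?S)"
    using assms \<beta>_nonneg std_normal_tail_pos[of \<tau>]
    by (intro mult_left_mono expectation_exp_majorant_le) auto
  finally show ?thesis
    using prob_le_stein[of \<tau>] by (simp add: algebra_simps)
qed

end

subsection \<open>Comparison of constants\<close>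

lemma exp_1_ge: "27 / 10 \<le> exp (1::real)"
  using abs_le_D2[OF e_approx_32] by simp

text \<open>\<open>\<sigma> * R_rel R \<sigma> = R\<close> produces the factor \<open>R\<close>.
  With \<open>\<kappa>\<close> and \<open>E\<close> as below, \<open>T4 + T5\<close> at
  \<open>p = 2\<close>, \<open>m = 1\<close> is
  \<open>R * sqrt 2 * (exp 1 + 2) * \<kappa> * E\<close>, and the numerical lower bounds 2.7 * 1.41
  * 4.7 * 0.198 * 6.29 multiply to more than 22.\<close>

lemma K_sup_ge:
  assumes "0 < \<sigma>" "2 * \<sigma> \<le> R"
  shows "20 * R \<le> exp 1 * K_sup R \<sigma>"
proof -
  have R: "0 < R" using assms by simp
  define \<kappa> where "\<kappa> = pi powr (1/4) * exp (19/300) / (4 * sqrt 3)"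
  define E where "E = exp ((R_rel R \<sigma>)\<^sup>2 / 2) - 1"
  have e: "27 / 10 \<le> exp (1::real)"
    by (rule exp_1_ge)
  have sqrt2: "141 / 100 \<le> sqrt 2"
    by (rule real_le_rsqrt) (simp add: power2_eq_square)
  have \<kappa>: "198 / 1000 \<le> \<kappa>"
  proof -
    have "13 / 10 \<le> pi powr (1/4)"
    proof -
      have "(13 / 10 :: real) = ((13 / 10) ^ 4) powr (1/4)"
        by (simp add: powr_powr flip: powr_numeral)
      also have "\<dots> \<le> pi powr (1/4)"
        using pi_gt3 by (intro powr_mono2) (auto simp: eval_nat_numeral)
      finally show ?thesis .
    qed
    moreover have "106 / 100 \<le> exp (19 / 300 :: real)"
      using exp_ge_add_one_self[of "19 / 300"] by simp
    ultimately have "13 / 10 * (106 / 100) \<le> pi powr (1/4) * exp (19/300)"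
      by (intro mult_mono) auto
    moreover have "sqrt 3 \<le> 17321 / 10000"
      by (rule real_le_lsqrt) (auto simp: power2_eq_square)
    ultimately show ?thesis
      by (simp add: \<kappa>_def field_simps)
  qed
  have rel: "2 \<le> R_rel R \<sigma>" "\<sigma> * R_rel R \<sigma> = R"
    using assms by (auto simp: R_rel_def field_simps)
  \<comment> \<open>As \<open>R_rel R \<sigma>\<close> is at least 2, the exponent is at least 2,
    and 2.7^2 - 1 = 6.29.\<close>
  have E: "629 / 100 \<le> E"
  proof -
    have "(27 / 10)\<^sup>2 \<le> (exp (1::real))\<^sup>2"
      using e by (intro power_mono) auto
    also have "\<dots> = exp (2\<^sup>2 / 2)"
      by (simp add: power2_eq_square flip: exp_add)
    also have "\<dots> \<le> exp ((R_rel R \<sigma>)\<^sup>2 / 2)"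
      using power_mono[OF rel(1), of 2] by simp
    finally show ?thesis by (simp add: E_def power2_eq_square)
  qed
  \<comment> \<open>\<open>sqrt\<close> is negative at negative arguments, so the radicand in
    \<open>T1\<close> has to be checked; \<open>Rs\<close> is at least \<open>R / 2\<close>, hence
    at least \<open>\<sigma>\<close>.\<close>
  have "(Rs_rel R \<sigma>)\<^sup>2 \<ge> 1"
  proof -
    have "0 \<le> sqrt (R\<^sup>2 - 4 * \<sigma>\<^sup>2)"
      using power_mono[OF assms(2), of 2] assms by (simp add: power_mult_distrib)
    then have "1 \<le> Rs_rel R \<sigma>"
      using assms by (simp add: Rs_rel_def Rs_def field_simps del: real_sqrt_ge_0_iff)
    then show ?thesis by simp
  qed
  then have T1: "0 \<le> T1 R \<sigma>"
    using assms by (auto simp: T1_def intro!: add_nonneg_nonneg mult_nonneg_nonneg)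
  have T2: "0 \<le> T2 R \<sigma> 2" and T3: "0 \<le> T3 R \<sigma>"
    using assms by (auto simp: T2_def T3_def intro!: add_nonneg_nonneg mult_nonneg_nonneg divide_nonneg_nonneg)
  have T4: "T4 R \<sigma> = R * (sqrt 2 * exp 1) * (\<kappa> * E)"
  proof -
    have "sqrt (exp 1) * (2 * exp 1) powr (1/2) = sqrt 2 * exp (1::real)"
      by (simp add: powr_half_sqrt real_sqrt_mult)
    then show ?thesis
      by (simp add: T4_def rel(2) \<kappa>_def E_def mult.assoc)
  qed
  \<comment> \<open>At \<open>p = 2\<close> the exponent \<open>2 - 2/p\<close> is 1, and at
    \<open>m = 1\<close> the denominator is \<open>sqrt 2\<close>.\<close>
  have T5: "T5 R \<sigma> 2 1 = R * (2 * sqrt 2) * (\<kappa> * E)"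
  proof -
    have "4 / sqrt 2 = 2 * sqrt 2"
      by (simp add: field_simps)
    moreover have "T5 R \<sigma> 2 1 = (\<sigma> * R_rel R \<sigma>) * (4 / sqrt 2) * (\<kappa> * E)"
      using rel(1) by (simp add: T5_def \<kappa>_def E_def)
    ultimately show ?thesis by (simp add: rel(2))
  qed
  have "T4 R \<sigma> + T5 R \<sigma> 2 1 \<le> K R \<sigma> 2 1"
    using T1 T2 T3 by (simp add: K_def le_max_iff_disj)
  also have "\<dots> \<le> K_tilde R \<sigma> 2 1"
  proof -
    have "sqrt (1 / 2) < 1" by (simp add: real_sqrt_divide)
    then have "0 \<le> ln ((1 + sqrt (1/2)) / (1 - sqrt (1/2)))"
      by (intro ln_ge_zero) (simp add: le_divide_eq)
    moreover have "x \<le> max (x + y + z + w) v" if "0 \<le> y" "0 \<le> z" "0 \<le> w" for x y z w v :: real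
      using that by (simp add: le_max_iff_disj)
    ultimately show ?thesis
      unfolding K_tilde_def using assms R by (auto intro!: mult_nonneg_nonneg)
  qed
  also have "\<dots> \<le> K_sup R \<sigma>"
    unfolding K_sup_def
    using cSUP_upper[OF _ bdd_above_K_tilde[OF R assms(1)], of "(2, 1)"] by simp
  finally have K: "T4 R \<sigma> + T5 R \<sigma> 2 1 \<le> K_sup R \<sigma>" .
  have \<kappa>E: "(198 / 1000) * (629 / 100) \<le> \<kappa> * E"
    using \<kappa> E by (intro mult_mono) auto
  have "141 / 100 * (27 / 10 + 2) \<le> sqrt 2 * (exp 1 + 2)"
    using e sqrt2 by (intro mult_mono) auto
  from mult_mono[OF this \<kappa>E]
  have "141 / 100 * (27 / 10 + 2) * ((198 / 1000) * (629 / 100)) \<le> sqrt 2 * (exp 1 + 2) * (\<kappa> * E)"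
    by simp
  from mult_mono[OF e this]
  have "27 / 10 * (141 / 100 * (27 / 10 + 2) * ((198 / 1000) * (629 / 100)))
      \<le> exp 1 * (sqrt 2 * (exp 1 + 2) * (\<kappa> * E))"
    by simp
  then have "20 \<le> exp 1 * (sqrt 2 * (exp 1 + 2) * (\<kappa> * E))"
    by simp
  then have "R * 20 \<le> R * (exp 1 * (sqrt 2 * (exp 1 + 2) * (\<kappa> * E)))"
    using R by (intro mult_left_mono) auto
  also have "\<dots> = exp 1 * (T4 R \<sigma> + T5 R \<sigma> 2 1)"
    unfolding T4 T5 by (simp add: algebra_simps)
  also have "\<dots> \<le> exp 1 * K_sup R \<sigma>"
    using K by (intro mult_left_mono) auto
  finally show ?thesis by simp
qed

section \<open>Both tail bounds against the claimed bound\<close>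

lemma sum_one_plus_squares:
  "(\<Sum>j = 1..J. 1 + (real j)\<^sup>2) = real J + real J * (real J + 1) * (2 * real J + 1) / 6"
  by (induction J) (auto simp: field_simps power2_eq_square)

text \<open>By the mean value theorem the difference is \<open>\<beta>\<close> times the density at
  some point between \<open>t - \<beta>\<close> and \<open>t\<close>, where it exceeds the density
  at \<open>t\<close> by a factor of at most \<open>exp (t * \<beta>) \<le> 3\<close>.\<close>

lemma std_normal_tail_shift_le:
  assumes "0 \<le> \<beta>" "\<beta> \<le> t" "t * \<beta> \<le> 1"
  shows "std_normal_tail (t - \<beta>) \<le> std_normal_tail t + 3 * \<beta> * std_normal_density t"
proof (cases "\<beta> = 0")
  case False
  then have "t - \<beta> < t" using assms by simp
  from MVT2[OF this DERIV_std_normal_tail] obtain z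
    where z: "t - \<beta> < z" "z < t"
      "std_normal_tail t - std_normal_tail (t - \<beta>) = (t - (t - \<beta>)) * - std_normal_density z"
    by blast
  have "(t - \<beta>)\<^sup>2 \<le> z\<^sup>2"
    using z assms by (intro power_mono) auto
  moreover have "(t - \<beta>)\<^sup>2 = t\<^sup>2 - 2 * (t * \<beta>) + \<beta>\<^sup>2"
    by (simp add: power2_eq_square algebra_simps)
  ultimately have "- z\<^sup>2 / 2 \<le> t * \<beta> + - t\<^sup>2 / 2"
    using zero_le_power2[of \<beta>] by linarith
  then have "exp (- z\<^sup>2 / 2) \<le> exp (t * \<beta>) * exp (- t\<^sup>2 / 2)"
    unfolding exp_add[symmetric] by simp
  also have "\<dots> \<le> 3 * exp (- t\<^sup>2 / 2)"
  proof (intro mult_right_mono)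
    have "exp (t * \<beta>) \<le> exp 1" using assms by simp
    then show "exp (t * \<beta>) \<le> 3" using exp_le by linarith
  qed simp
  finally have "std_normal_density z \<le> 3 * std_normal_density t"
    by (simp add: std_normal_density_def field_simps)
  then have "\<beta> * std_normal_density z \<le> \<beta> * (3 * std_normal_density t)"
    using assms by (intro mult_left_mono)
  then show ?thesis using z(3) by simp
qed simp

lemma ln_mult_std_normal_density:
  assumes "0 < c"
  shows "ln (c * std_normal_density t) = ln c - t\<^sup>2 / 2 - ln (sqrt (2 * pi))"
  using assms by (simp add: std_normal_density_def ln_mult ln_div)

text \<open>With \<open>L\<close>, \<open>A\<close> and \<open>q\<close> as below, dropping the tail
  leaves \<open>exp (- L / (1 + A))\<close> on the right, so the claim reduces to
  \<open>L / (1 + A) \<le> t^2 / (2 * (1 + q))\<close>. It holds since \<open>L\<close> is at most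
  \<open>t^2 / 2 + t + 1\<close>, \<open>A\<close> is at least 1 and \<open>q\<close> is at most
  \<open>A / 60\<close>.\<close>

lemma bernstein_le_bound:
  assumes t: "3 \<le> t" and c: "0 < c" "1 \<le> c * (t + 1)" and \<beta>: "0 \<le> \<beta>" "20 * \<beta> \<le> c"
  shows "exp (- (t\<^sup>2 / (2 * (1 + \<beta> * t / 3)))) \<le> (std_normal_tail t + c * std_normal_density t)
    * (c * std_normal_density t) powr (- (c * (t + 1) / (c * (t + 1) + 1)))"
proof -
  define A where "A = c * (t + 1)"
  define L where "L = - ln (c * std_normal_density t)"
  define q where "q = \<beta> * t / 3"
  have A: "1 \<le> A" using c by (simp add: A_def)
  have q: "0 \<le> q" using \<beta> t by (simp add: q_def)
  have "60 * q \<le> A"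
    using mult_mono[OF \<beta>(2), of t "t + 1"] t c by (simp add: A_def q_def mult.assoc)
  have pos: "0 < c * std_normal_density t"
    using c std_normal_density_pos[of t] by simp
  have "ln (sqrt (2 * pi)) \<le> 1"
  proof -
    have "sqrt (2 * pi) \<le> 27 / 10"
      using pi_less_4 pi_approx by (intro real_le_lsqrt) (auto simp: power2_eq_square)
    also have "\<dots> \<le> exp 1" by (rule exp_1_ge)
    finally show ?thesis using ln_mono[of "sqrt (2 * pi)" "exp 1"] by simp
  qed
  \<comment> \<open>The case assumption bounds \<open>c\<close> below by \<open>1 / (t + 1)\<close>,
    so \<open>- ln c\<close> is only logarithmic in \<open>t\<close>.\<close>
  moreover have "- ln c \<le> t"
  proof -
    have "0 \<le> ln (c * (t + 1))" using c by simp
    also have "\<dots> = ln c + ln (t + 1)" using c t by (simp add: ln_mult)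
    finally show ?thesis using ln_add_one_self_le_self[of t] t by (simp add: add.commute)
  qed
  ultimately have L: "L \<le> t\<^sup>2 / 2 + (1 + t)"
    unfolding L_def ln_mult_std_normal_density[OF c(1)] by simp
  have "L * (1 + q) \<le> (t\<^sup>2 / 2 + (1 + t)) * (1 + q)"
    using L q by (intro mult_right_mono) auto
  also have "\<dots> \<le> (t\<^sup>2 / 2 + (1 + t)) * (1 + A / 60)"
    using \<open>60 * q \<le> A\<close> t by (intro mult_left_mono) auto
  also have "\<dots> \<le> t\<^sup>2 / 2 * (1 + A)"
  proof -
    have "(1 + t) * (1 + A / 60) \<le> (1 + t) * (61 / 60 * A)"
      using A t by (intro mult_left_mono) auto
    \<comment> \<open>59/120 is what is left of 1/2 after the loss of \<open>A / 60\<close>. The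
      product below is 59 t^2 - 122 t - 165, nonnegative from \<open>t = 3\<close> on, while 59 t^2
      \<ge> 122 (1 + t) suffices.\<close>
    also have "\<dots> \<le> 59 / 120 * t\<^sup>2 * A"
    proof -
      have "0 \<le> (t - 3) * (59 * t + 55)" using t by (intro mult_nonneg_nonneg) auto
      then have "(1 + t) * (61 / 60) \<le> 59 / 120 * t\<^sup>2" by (simp add: power2_eq_square algebra_simps)
      from mult_right_mono[OF this, of A] show ?thesis using A by simp
    qed
    finally have "(1 + t) * (1 + A / 60) \<le> 59 / 120 * t\<^sup>2 * A" .
    moreover have "(t\<^sup>2 / 2 + (1 + t)) * (1 + A / 60)
        = t\<^sup>2 / 2 * (1 + A) - 59 / 120 * t\<^sup>2 * A + (1 + t) * (1 + A / 60)"
      by (simp add: field_simps)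
    ultimately show ?thesis by linarith
  qed
  finally have "L / (1 + A) \<le> t\<^sup>2 / (2 * (1 + q))"
    using A q by (simp add: field_simps)
  moreover have "L / (1 + A) = L - A / (A + 1) * L"
    using A by (simp add: field_simps)
  ultimately have "exp (- (t\<^sup>2 / (2 * (1 + q)))) \<le> exp (- L + A / (A + 1) * L)"
    by simp
  also have "\<dots> = (c * std_normal_density t) * (c * std_normal_density t) powr (- (A / (A + 1)))"
  proof -
    have "exp (- L) = c * std_normal_density t"
      unfolding L_def minus_minus using pos by (rule exp_ln)
    moreover have "exp (A / (A + 1) * L) = (c * std_normal_density t) powr (- (A / (A + 1)))"
      using less_imp_neq[OF pos] by (simp add: powr_def L_def)
    ultimately show ?thesis by (simp only: exp_add)
  qed
  also have "\<dots> \<le> (std_normal_tail t + c * std_normal_density t) * (c * std_normal_density t) powr (- (A / (A + 1)))"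
    using std_normal_tail_pos[of t] by (intro mult_right_mono) auto
  finally show ?thesis by (simp add: A_def q_def)
qed

text \<open>The factors are compared separately. Moving the tail from \<open>t - \<beta>\<close> to
  \<open>t\<close> costs at most \<open>3 * \<beta>\<close> times the density, covered by
  \<open>c\<close>. The correction is at most \<open>exp (X + Y)\<close> with \<open>X + Y\<close>
  of order \<open>\<beta> * T^3\<close>, and the power on the right is
  \<open>exp (A / (A + 1) * L)\<close> with \<open>L\<close> at least
  \<open>t^2 / 2 + 1\<close>.\<close>

lemma stein_le_bound:
  assumes t: "2 \<le> t" and c: "0 < c" "c * (t + 1) \<le> 1" and \<beta>: "0 \<le> \<beta>" "20 * \<beta> \<le> c"
  defines "J \<equiv> nat \<lceil>t - \<beta>\<rceil>"
  shows "std_normal_tail (t - \<beta>) * (1 + \<beta> * sqrt (2 * pi) * (1 / 2 + exp (1 / 2) *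
      (\<Sum>j = 1..J. (1 + (real j)\<^sup>2)
        * exp (real j * \<beta> - (real j)\<^sup>2 / 2 + (real j)\<^sup>2 / (2 * (1 - real j * \<beta> / 3))))))
    \<le> (std_normal_tail t + c * std_normal_density t)
      * (c * std_normal_density t) powr (- (c * (t + 1) / (c * (t + 1) + 1)))"
proof -
  define T where "T = t + 1"
  define A where "A = c * T"
  define L where "L = - ln (c * std_normal_density t)"
  \<comment> \<open>\<open>Y\<close> bounds every exponent in the sum; \<open>P\<close> is the
    closed form of the sum of \<open>1 + j^2\<close> evaluated at \<open>T\<close>. In
    \<open>X\<close>, 2.51 and 1.65 are upper bounds for \<open>sqrt (2 * pi)\<close> and
    \<open>exp (1 / 2)\<close>.\<close>
  define Y where "Y = T * \<beta> + T ^ 3 * \<beta> / 5"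
  define P where "P = T + T * (T + 1) * (2 * T + 1) / 6"
  define X where "X = \<beta> * (251 / 100) * (1 / 2 + 165 / 100 * P)"
  have T: "3 \<le> T" using t by (simp add: T_def)
  have A: "0 < A" "A \<le> 1" using c T by (auto simp: A_def T_def)
  have \<beta>T: "20 * (\<beta> * T) \<le> A"
    using mult_right_mono[OF \<beta>(2), of T] T by (simp add: A_def)
  have "c * 3 \<le> c * T" using c T by (intro mult_left_mono) auto
  then have c3: "c \<le> 1 / 3" using A by (simp add: A_def)
  have J: "real J \<le> T"
    using t \<beta> c3 unfolding J_def T_def by linarith
  have pos: "0 < c * std_normal_density t"
    using c std_normal_density_pos[of t] by simp
  have P: "0 \<le> P" using T by (simp add: P_def)
  have Y: "0 \<le> Y" using \<beta> T by (simp add: Y_def)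

  have tail: "std_normal_tail (t - \<beta>) \<le> std_normal_tail t + c * std_normal_density t"
  proof -
    have "t * \<beta> \<le> 1"
      using \<beta>T A \<beta>(1) by (simp add: T_def algebra_simps)
    then have "std_normal_tail (t - \<beta>) \<le> std_normal_tail t + 3 * \<beta> * std_normal_density t"
      using \<beta> t c3 by (intro std_normal_tail_shift_le) auto
    also have "3 * \<beta> * std_normal_density t \<le> c * std_normal_density t"
      using \<beta> by (intro mult_right_mono) auto
    finally show ?thesis by simp
  qed

  have exponent: "real j * \<beta> - (real j)\<^sup>2 / 2 + (real j)\<^sup>2 / (2 * (1 - real j * \<beta> / 3)) \<le> Y"
    if "j \<in> {1..J}" for j
  proof -
    define x where "x = real j * \<beta> / 3"
    have jT: "real j \<le> T" using that J by simp
    then have jb: "real j * \<beta> \<le> T * \<beta>" using \<beta> by (intro mult_right_mono) auto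
    then have x: "0 \<le> x" "x \<le> 1 / 60"
      using \<beta>T A \<beta> by (auto simp: x_def mult.commute)
    \<comment> \<open>Valid for \<open>x\<close> up to 1/6. After the quadratic terms cancel, the
      excess \<open>6 / 5 * x\<close> leaves \<open>j^3 * \<beta> / 5\<close>, the second summand of
      \<open>Y\<close>.\<close>
    have "1 / (1 - x) \<le> 1 + 6 / 5 * x"
    proof -
      have "0 \<le> x * (1 / 5 - 6 / 5 * x)" using x by (intro mult_nonneg_nonneg) auto
      then have "1 \<le> (1 + 6 / 5 * x) * (1 - x)" by (simp add: algebra_simps)
      then show ?thesis using x by (simp add: field_simps)
    qed
    then have "(real j)\<^sup>2 / 2 * (1 / (1 - x)) \<le> (real j)\<^sup>2 / 2 * (1 + 6 / 5 * x)"
      by (intro mult_left_mono) auto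
    also have "\<dots> = (real j)\<^sup>2 / 2 + real j ^ 3 * \<beta> / 5"
      by (simp add: x_def power2_eq_square power3_eq_cube algebra_simps)
    also have "\<dots> \<le> (real j)\<^sup>2 / 2 + T ^ 3 * \<beta> / 5"
      using jT \<beta> by (intro add_left_mono divide_right_mono mult_right_mono power_mono) auto
    finally show ?thesis
      using jb by (simp add: Y_def x_def)
  qed

  have "(\<Sum>j = 1..J. (1 + (real j)\<^sup>2)
        * exp (real j * \<beta> - (real j)\<^sup>2 / 2 + (real j)\<^sup>2 / (2 * (1 - real j * \<beta> / 3))))
      \<le> (\<Sum>j = 1..J. (1 + (real j)\<^sup>2) * exp Y)"
    using exponent by (intro sum_mono mult_left_mono) auto
  also have "\<dots> = (real J + real J * (real J + 1) * (2 * real J + 1) / 6) * exp Y"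
    unfolding sum_distrib_right[symmetric] sum_one_plus_squares ..
  also have "\<dots> \<le> P * exp Y"
    unfolding P_def using J T
    by (intro mult_right_mono add_mono divide_right_mono mult_mono) auto
  finally have sum_le: "(\<Sum>j = 1..J. (1 + (real j)\<^sup>2)
        * exp (real j * \<beta> - (real j)\<^sup>2 / 2 + (real j)\<^sup>2 / (2 * (1 - real j * \<beta> / 3)))) \<le> P * exp Y"
    (is "?S \<le> _") .
  have "sqrt (2 * pi) \<le> 251 / 100"
    using pi_approx by (intro real_le_lsqrt) (auto simp: power2_eq_square)
  moreover have "1 / 2 + exp (1 / 2) * ?S \<le> (1 / 2 + 165 / 100 * P) * exp Y"
  proof -
    have "exp (1 / 2 :: real) \<le> 165 / 100"
    proof (rule power2_le_imp_le)
      have "(exp (1 / 2 :: real))\<^sup>2 = exp 1"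
        by (simp add: power2_eq_square flip: exp_add)
      also have "\<dots> \<le> (165 / 100)\<^sup>2"
        using e_less_272 by (simp add: power2_eq_square)
      finally show "(exp (1 / 2 :: real))\<^sup>2 \<le> (165 / 100)\<^sup>2" .
    qed simp
    then have "exp (1 / 2) * ?S \<le> 165 / 100 * (P * exp Y)"
      using sum_le by (intro mult_mono) (auto intro!: sum_nonneg)
    moreover have "1 / 2 \<le> 1 / 2 * exp Y" using Y by simp
    moreover have "1 / 2 + r \<le> (1 / 2 + 165 / 100 * P) * e"
      if "r \<le> 165 / 100 * (P * e)" "1 / 2 \<le> 1 / 2 * e" for r e :: real
      using that by (simp add: algebra_simps)
    ultimately show ?thesis by blast
  qed
  ultimately have "\<beta> * sqrt (2 * pi) * (1 / 2 + exp (1 / 2) * ?S)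
      \<le> \<beta> * (251 / 100) * ((1 / 2 + 165 / 100 * P) * exp Y)"
    using \<beta> by (intro mult_mono) (auto intro!: add_nonneg_nonneg mult_nonneg_nonneg sum_nonneg)
  also have "\<dots> = X * exp Y" by (simp add: X_def)
  finally have "1 + \<beta> * sqrt (2 * pi) * (1 / 2 + exp (1 / 2) * ?S) \<le> 1 + X * exp Y"
    by simp
  also have "\<dots> \<le> (1 + X) * exp Y"
    using Y by (simp add: algebra_simps)
  also have "\<dots> \<le> exp X * exp Y"
    by (intro mult_right_mono) auto
  also have "\<dots> = exp (X + Y)" by (simp add: exp_add)
  also have "X + Y \<le> A / (A + 1) * L"
  proof -
    \<comment> \<open>Times \<open>\<beta>\<close>, the left side is \<open>X + Y\<close> and the
      right side is \<open>10 * (\<beta> * T) * (t^2 / 2 + 1)\<close>, ready for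
      \<open>20 * (\<beta> * T) \<le> A\<close>. The constant 1/2 is absorbed into
      \<open>T / 6\<close>, as \<open>T\<close> is at least 3.\<close>
    have "251 / 100 * (1 / 2 + 165 / 100 * P) + T + T ^ 3 / 5 \<le> T * (5 * t\<^sup>2 + 10)"
    proof -
      have "251 / 100 * (1 / 2 + 165 / 100 * P) + T + T ^ 3 / 5
          \<le> 251 / 100 * (T / 6 + 165 / 100 * P) + T + T ^ 3 / 5"
        using T by simp
      also have "\<dots> = T * (251 / 100 * (1 / 6 + 165 / 100 * (1 + (T + 1) * (2 * T + 1) / 6)) + 1 + T\<^sup>2 / 5)"
        by (simp add: P_def algebra_simps power2_eq_square power3_eq_cube)
      also have "\<dots> \<le> T * (5 * t\<^sup>2 + 10)"
      proof (intro mult_left_mono)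
        \<comment> \<open>A quadratic lying slightly below the difference of the two sides for
          \<open>T \<ge> 3\<close>, chosen to have the root 3.\<close>
        have "0 \<le> (T - 3) * (34195 / 10000 * T - 19 / 10)"
          using T by (intro mult_nonneg_nonneg) auto
        also have "\<dots> = 34195 / 10000 * T\<^sup>2 - 121585 / 10000 * T + 57 / 10"
          by (simp add: field_simps power2_eq_square)
        finally have ***: "0 \<le> 34195 / 10000 * T\<^sup>2 - 121585 / 10000 * T + 57 / 10" .
        have *: "(T + 1) * (2 * T + 1) = 2 * T\<^sup>2 + 3 * T + 1"
          by (simp add: algebra_simps power2_eq_square)
        have **: "t\<^sup>2 = T\<^sup>2 - 2 * T + 1"
          by (simp add: T_def algebra_simps power2_eq_square)
        show "251 / 100 * (1 / 6 + 165 / 100 * (1 + (T + 1) * (2 * T + 1) / 6)) + 1 + T\<^sup>2 / 5 \<le> 5 * t\<^sup>2 + 10"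
          unfolding * ** using *** T by (simp add: field_simps)
      qed (use T in simp)
      finally show ?thesis .
    qed
    from mult_left_mono[OF this \<beta>(1)]
    have "X + Y \<le> 10 * (\<beta> * T) * (t\<^sup>2 / 2 + 1)"
      by (simp add: X_def Y_def algebra_simps)
    also have "\<dots> \<le> A / 2 * (t\<^sup>2 / 2 + 1)"
      using \<beta>T by (intro mult_right_mono) auto
    also have "\<dots> \<le> A / (A + 1) * L"
    proof (intro mult_mono)
      \<comment> \<open>Here \<open>A \<le> 1\<close> enters. The bound
        \<open>t^2 / 2 + 1 \<le> L\<close> then comes from \<open>c \<le> 1 / 3\<close> and
        \<open>exp 1 \<le> 3\<close>.\<close>
      show "A / 2 \<le> A / (A + 1)" using A by (intro divide_left_mono) auto
      have "ln c \<le> ln (1 / 3)" using c c3 by (subst ln_le_cancel_iff) auto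
      also have "\<dots> \<le> - 1"
        using ln_mono[of "exp 1" 3] exp_le by (simp add: ln_div)
      finally have "ln c \<le> - 1" .
      moreover have "0 \<le> ln (sqrt (2 * pi))" using pi_gt3 by simp
      ultimately show "t\<^sup>2 / 2 + 1 \<le> L"
        unfolding L_def ln_mult_std_normal_density[OF c(1)] by linarith
    qed (use A in auto)
    finally show ?thesis .
  qed
  also have "exp (A / (A + 1) * L) = (c * std_normal_density t) powr (- (A / (A + 1)))"
    using less_imp_neq[OF pos] by (simp add: powr_def L_def)
  finally have "1 + \<beta> * sqrt (2 * pi) * (1 / 2 + exp (1 / 2) * ?S)
      \<le> (c * std_normal_density t) powr (- (A / (A + 1)))"
    by simp
  then show ?thesis
    unfolding A_def T_def using tail pos std_normal_tail_pos[of "t - \<beta>"] std_normal_tail_pos[of t] \<beta>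
    by (intro mult_mono) (auto intro!: add_nonneg_nonneg sum_nonneg mult_nonneg_nonneg)
qed

text \<open>The two regimes meet at \<open>c * (t + 1) = 1\<close>. In the second one the Stein
  bound is used with \<open>\<tau> = t - \<beta>\<close>, which is positive since \<open>c\<close>
  is at most 1/3.\<close>

lemma (in bounded_indep_sum) prob_le_bound:
  assumes c: "0 < c" "20 * \<beta> \<le> c" and t: "4 * c + 2 \<le> t"
  shows "prob {\<omega> \<in> space M. t \<le> W \<omega>} \<le> (std_normal_tail t + c * std_normal_density t)
    * (c * std_normal_density t) powr (- (c * (t + 1) / (c * (t + 1) + 1)))"
proof (cases "1 \<le> c * (t + 1)")
  case True
  \<comment> \<open>If \<open>t < 3\<close>, the threshold \<open>4 * c + 2 \<le> t\<close> gives
    \<open>4 * c < 1\<close>, and then \<open>c * (t + 1)\<close> is below 1.\<close>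
  have "3 \<le> t"
  proof (rule ccontr)
    assume "\<not> 3 \<le> t"
    then have "c * (t + 1) < c * 4" using c by simp
    also have "\<dots> \<le> 1" using t \<open>\<not> 3 \<le> t\<close> by simp
    finally show False using True by simp
  qed
  then show ?thesis
    using bernstein[of t] bernstein_le_bound[OF _ c(1) True \<beta>_nonneg c(2)] by simp
next
  case False
  have "c * 3 \<le> c * (t + 1)" using c t by (intro mult_left_mono) auto
  then have c3: "c \<le> 1 / 3" using False by simp
  have J: "real (nat \<lceil>t - \<beta>\<rceil>) \<le> t + 1"
    using \<beta>_nonneg t c by linarith
  have "real (nat \<lceil>t - \<beta>\<rceil>) * \<beta> \<le> (t + 1) * c"
    using J \<beta>_nonneg c t by (intro mult_mono) auto
  then have small: "real (nat \<lceil>t - \<beta>\<rceil>) * \<beta> < 3"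
    using False by (simp add: mult.commute)
  have \<tau>: "0 < t - \<beta>" using c c3 t by simp
  show ?thesis
    using prob_le_tail_mult[OF \<tau> small]
      stein_le_bound[of t c \<beta>] c t False \<beta>_nonneg by simp
qed

subsection \<open>The normalised bridge\<close>

text \<open>Popoviciu's inequality: \<open>Z^2 \<le> R * Z\<close> pointwise bounds the variance by
  \<open>R * \<mu> - \<mu>^2\<close>, which is largest at \<open>\<mu> = R / 2\<close>. It supplies
  \<open>2 * \<sigma> \<le> R\<close>.\<close>

lemma (in prob_space) variance_le_square_half_range:
  fixes Z :: "'a \<Rightarrow> real"
  assumes [measurable]: "Z \<in> borel_measurable M"
    and Z: "\<And>\<omega>. \<omega> \<in> space M \<Longrightarrow> Z \<omega> \<in> {0..R}"
  shows "variance Z \<le> (R / 2)\<^sup>2"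
proof -
  define \<mu> where "\<mu> = expectation Z"
  have int: "integrable M Z"
    by (rule integrable_const_bound[where B = R]) (use Z in auto)
  have int2: "integrable M (\<lambda>\<omega>. (Z \<omega> - \<mu>)\<^sup>2)"
    by (rule integrable_continuous_bounded[where f = "\<lambda>z. (z - \<mu>)\<^sup>2" and B = R])
       (use Z in \<open>auto intro!: continuous_intros\<close>)
  have "variance Z \<le> expectation (\<lambda>\<omega>. (R - 2 * \<mu>) * Z \<omega> + \<mu>\<^sup>2)"
    unfolding \<mu>_def[symmetric]
  proof (rule integral_mono[OF int2])
    fix \<omega> assume "\<omega> \<in> space M"
    then have "Z \<omega> * Z \<omega> \<le> R * Z \<omega>"
      using Z by (intro mult_right_mono) auto
    then show "(Z \<omega> - \<mu>)\<^sup>2 \<le> (R - 2 * \<mu>) * Z \<omega> + \<mu>\<^sup>2"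
      by (simp add: power2_eq_square algebra_simps)
  qed (use int in simp)
  also have "\<dots> = (R - 2 * \<mu>) * \<mu> + \<mu>\<^sup>2"
    using int by (simp add: \<mu>_def prob_space)
  also have "\<dots> \<le> (R / 2)\<^sup>2"
    using zero_le_power2[of "R / 2 - \<mu>"] by (simp add: power2_eq_square algebra_simps)
  finally show ?thesis .
qed

lemma bridge_eq_weighted_sum:
  assumes "k \<le> n"
  shows "bridge M Y n k \<omega> = (\<Sum>i = 1..n. ((if i \<le> k then 1 else 0) - real k / real n) * centred M Y i \<omega>)"
proof -
  have "(\<Sum>i = 1..k. centred M Y i \<omega>) = (\<Sum>i = 1..n. if i \<le> k then centred M Y i \<omega> else 0)"
    using assms by (intro sum.mono_neutral_cong_left) auto
  then show ?thesis
    unfolding bridge_def centred_sum_def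
    by (simp add: sum_distrib_left sum_subtractf[symmetric] left_diff_distrib if_distrib[of "\<lambda>x. x * _"] cong: if_cong)
qed

lemma sum_bridge_weights_squared:
  assumes "0 < k" "k \<le> n"
  shows "(\<Sum>i = 1..n. ((if i \<le> k then 1 else 0) - real k / real n)\<^sup>2) = real k * (real n - real k) / real n"
proof -
  define r where "r = real k / real n"
  have "(\<Sum>i = 1..n. ((if i \<le> k then 1 else 0) - r)\<^sup>2)
      = (\<Sum>i = 1..n. (if i \<le> k then 1 - 2 * r else 0) + r\<^sup>2)"
    by (intro sum.cong) (auto simp: power2_eq_square algebra_simps)
  also have "\<dots> = (\<Sum>i = 1..n. if i \<le> k then 1 - 2 * r else 0) + real n * r\<^sup>2"
    by (simp add: sum.distrib)
  also have "(\<Sum>i = 1..n. if i \<le> k then 1 - 2 * r else 0) = (\<Sum>i = 1..k. 1 - 2 * r)"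
    using assms by (intro sum.mono_neutral_cong_right) auto
  also have "\<dots> + real n * r\<^sup>2 = real k * (real n - real k) / real n"
    using assms by (simp add: r_def field_simps power2_eq_square)
  finally show ?thesis by (simp add: r_def)
qed

theorem corollary5p2p1:
  fixes M :: "'a measure" and Y :: "nat \<Rightarrow> 'a \<Rightarrow> real"
    and R \<sigma> t :: real and n k :: nat
  assumes "prob_space M"
    and "prob_space.indep_vars M (\<lambda>_. borel) Y {1..}"
    and "\<And>i. i \<ge> 1 \<Longrightarrow> distr M borel (Y i) = distr M borel (Y 1)"
    and "AE \<omega> in M. Y 1 \<omega> \<in> {0..R}"
    and "prob_space.variance M (Y 1) = \<sigma>\<^sup>2"
    and "\<sigma> > 0"
    and "0 < k" and "k < n"
    and "t \<ge> 4 * exp 1 * K_sup R \<sigma> / bridge_sd \<sigma> n k + 2"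
  shows "measure M {\<omega> \<in> space M. 1 / bridge_sd \<sigma> n k * bridge M Y n k \<omega> \<ge> t}
    \<le> std_normal_tail t
      * (1 + exp 1 * K_sup R \<sigma> * std_normal_density t / (std_normal_tail t * bridge_sd \<sigma> n k))
      * (exp 1 * K_sup R \<sigma> * std_normal_density t / bridge_sd \<sigma> n k)
          powr (- (exp 1 * K_sup R \<sigma> * (t + 1)
                   / (exp 1 * K_sup R \<sigma> * (t + 1) + bridge_sd \<sigma> n k)))"
proof -
  interpret prob_space M by fact
  define \<mu> where "\<mu> = expectation (Y 1)"
  define s where "s = bridge_sd \<sigma> n k"
  define w where "w i = (if i \<le> k then 1 else 0) - real k / real n" for i
  \<comment> \<open>Truncation changes \<open>Y i\<close> only on a null set and puts the values
    into \<open>{0..R}\<close> at every point, as the locale demands.\<close>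
  define Z where "Z i \<omega> = min (max (Y i \<omega>) 0) R" for i \<omega>
  define X where "X i \<omega> = w i / s * (Z i \<omega> - \<mu>)" for i \<omega>
  \<comment> \<open>The weight is negative for \<open>i > k\<close>, which swaps the images of 0 and
    \<open>R\<close>; hence \<open>min\<close> and \<open>max\<close>.\<close>
  define a where "a i = min (w i / s * (0 - \<mu>)) (w i / s * (R - \<mu>))" for i
  define b where "b i = max (w i / s * (0 - \<mu>)) (w i / s * (R - \<mu>))" for i
  have Y_meas [measurable]: "Y i \<in> borel_measurable M" if "1 \<le> i" for i
    using assms(2) that by (simp add: indep_vars_def)
  have Z_meas [measurable]: "Z i \<in> borel_measurable M" if "1 \<le> i" for i
    using that unfolding Z_def[abs_def] by measurable
  have Y_AE: "AE \<omega> in M. Y i \<omega> \<in> {0..R}" if "1 \<le> i" for i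
  proof -
    have "AE y in distr M borel (Y i). y \<in> {0..R}"
      unfolding assms(3)[OF that] using assms(4) by (subst AE_distr_iff) auto
    then show ?thesis
      using that by (subst (asm) AE_distr_iff) auto
  qed
  have "AE \<omega> in M. 0 \<le> R"
    using assms(4) by eventually_elim simp
  then have "0 \<le> R" by simp
  have Z_mem: "Z i \<omega> \<in> {0..R}" for i \<omega>
    using \<open>0 \<le> R\<close> by (auto simp: Z_def)
  have Z_AE: "AE \<omega> in M. Z i \<omega> = Y i \<omega>" if "1 \<le> i" for i
    using Y_AE[OF that] by eventually_elim (auto simp: Z_def)
  have E_Y: "expectation (\<lambda>\<omega>. f (Y i \<omega>)) = expectation (\<lambda>\<omega>. f (Y 1 \<omega>))"
    if "1 \<le> i" "f \<in> borel_measurable borel" for i and f :: "real \<Rightarrow> real"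
    using integral_distr[of "Y i" M borel f] integral_distr[of "Y 1" M borel f] that assms(3)[OF that(1)]
    by simp
  have E_Z: "expectation (\<lambda>\<omega>. f (Z i \<omega>)) = expectation (\<lambda>\<omega>. f (Y 1 \<omega>))"
    if "1 \<le> i" "f \<in> borel_measurable borel" for i and f :: "real \<Rightarrow> real"
  proof -
    have "expectation (\<lambda>\<omega>. f (Z i \<omega>)) = expectation (\<lambda>\<omega>. f (Y i \<omega>))"
      using Z_AE[OF that(1)] that by (intro integral_cong_AE) auto
    with E_Y[OF that] show ?thesis by simp
  qed
  have mean_Z: "expectation (Z i) = \<mu>" if "1 \<le> i" for i
    using E_Z[OF that, of "\<lambda>x. x"] by (simp add: \<mu>_def)
  have var_Z: "expectation (\<lambda>\<omega>. (Z i \<omega> - \<mu>)\<^sup>2) = \<sigma>\<^sup>2" if "1 \<le> i" for i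
    using E_Z[OF that, of "\<lambda>x. (x - \<mu>)\<^sup>2"] assms(5) by (simp add: \<mu>_def)
  have \<mu>: "0 \<le> \<mu>" "\<mu> \<le> R"
  proof -
    have int: "integrable M (Z 1)"
      by (rule integrable_const_bound[where B = R]) (use Z_mem in auto)
    show "0 \<le> \<mu>"
      using Z_mem unfolding mean_Z[OF order_refl, symmetric]
      by (intro Bochner_Integration.integral_nonneg) auto
    have "expectation (Z 1) \<le> expectation (\<lambda>_. R)"
      using Z_mem int by (intro integral_mono) auto
    then show "\<mu> \<le> R" by (simp add: mean_Z prob_space)
  qed
  have "\<sigma>\<^sup>2 \<le> (R / 2)\<^sup>2"
    using variance_le_square_half_range[of "Z 1" R] Z_mem by (simp add: mean_Z var_Z)
  then have \<sigma>R: "2 * \<sigma> \<le> R"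
    using \<open>0 \<le> R\<close> power2_le_imp_le[of \<sigma> "R / 2"] by simp
  have s_sq: "s\<^sup>2 = \<sigma>\<^sup>2 * (real k * (real n - real k) / real n)"
    unfolding s_def bridge_sd_def using assms(7,8) by (intro real_sqrt_pow2) auto
  have "0 < s"
    unfolding s_def bridge_sd_def using assms(6-8) by auto
  have w_abs: "\<bar>w i\<bar> \<le> 1" for i
    using assms(7,8) by (auto simp: w_def field_simps)

  interpret S: bounded_indep_sum M "{1..n}" X a b "R / s"
  proof
    have "indep_vars (\<lambda>_. borel) Y {1..n}"
      by (rule indep_vars_subset[OF assms(2)]) auto
    from indep_vars_compose2[OF this, of "\<lambda>i y. w i / s * (min (max y 0) R - \<mu>)" "\<lambda>_. borel"]
    show "indep_vars (\<lambda>_. borel) X {1..n}"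
      by (simp add: X_def[abs_def] Z_def)
  next
    fix i \<omega>
    show "X i \<omega> \<in> {a i..b i}"
    proof (cases "0 \<le> w i / s")
      case True
      then show ?thesis
        using mult_left_mono[OF _ True, of "0 - \<mu>" "Z i \<omega> - \<mu>"]
          mult_left_mono[OF _ True, of "Z i \<omega> - \<mu>" "R - \<mu>"] Z_mem[of i \<omega>]
        by (auto simp: X_def a_def b_def min_le_iff_disj le_max_iff_disj)
    next
      case False
      then have "w i / s \<le> 0" by simp
      then show ?thesis
        using mult_left_mono_neg[OF _ \<open>w i / s \<le> 0\<close>, of "0 - \<mu>" "Z i \<omega> - \<mu>"]
          mult_left_mono_neg[OF _ \<open>w i / s \<le> 0\<close>, of "Z i \<omega> - \<mu>" "R - \<mu>"] Z_mem[of i \<omega>]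
        by (auto simp: X_def a_def b_def min_le_iff_disj le_max_iff_disj)
    qed
  next
    fix i
    have "0 \<le> w i / s * (R - \<mu>) \<and> w i / s * (0 - \<mu>) \<le> 0
        \<or> 0 \<le> w i / s * (0 - \<mu>) \<and> w i / s * (R - \<mu>) \<le> 0"
    proof -
      have "0 \<le> x * (R - \<mu>) \<and> x * (0 - \<mu>) \<le> 0 \<or> 0 \<le> x * (0 - \<mu>) \<and> x * (R - \<mu>) \<le> 0" for x
        using \<mu> by (cases "0 \<le> x") (simp_all add: mult_nonpos_nonneg)
      then show ?thesis by blast
    qed
    then show "a i \<le> 0" "0 \<le> b i"
      by (auto simp: a_def b_def min_le_iff_disj le_max_iff_disj)
    have "b i - a i = \<bar>w i\<bar> * (R / s)"
    proof -
      have "b i - a i = \<bar>w i / s * (R - \<mu>) - w i / s * (0 - \<mu>)\<bar>"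
        by (auto simp: a_def b_def)
      also have "w i / s * (R - \<mu>) - w i / s * (0 - \<mu>) = w i * (R / s)"
        by (simp add: diff_divide_distrib right_diff_distrib)
      finally show ?thesis
        using \<open>0 < s\<close> \<open>0 \<le> R\<close> by (simp add: abs_mult)
    qed
    also have "\<dots> \<le> 1 * (R / s)"
      using w_abs \<open>0 < s\<close> \<open>0 \<le> R\<close> by (intro mult_right_mono) auto
    finally show "b i - a i \<le> R / s" by simp
  next
    fix i assume "i \<in> {1..n}"
    then have "1 \<le> i" by simp
    have "integrable M (Z i)"
      by (rule integrable_const_bound[where B = R]) (use Z_mem \<open>1 \<le> i\<close> in auto)
    then show "expectation (X i) = 0"
      unfolding X_def[abs_def] using mean_Z[OF \<open>1 \<le> i\<close>] by (simp add: prob_space)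
  next
    \<comment> \<open>Each summand is the squared weight times \<open>\<sigma>^2 / s^2\<close>, and
      the squared weights add up to \<open>s^2 / \<sigma>^2\<close>.\<close>
    have "(\<Sum>i = 1..n. expectation (\<lambda>\<omega>. (X i \<omega>)\<^sup>2)) = (\<Sum>i = 1..n. (w i)\<^sup>2 * (\<sigma>\<^sup>2 / s\<^sup>2))"
      by (intro sum.cong) (auto simp: X_def power_mult_distrib power_divide var_Z)
    also have "\<dots> = real k * (real n - real k) / real n * (\<sigma>\<^sup>2 / s\<^sup>2)"
      unfolding sum_distrib_right[symmetric] w_def
        sum_bridge_weights_squared[OF assms(7) less_imp_le[OF assms(8)]] ..
    also have "\<dots> = s\<^sup>2 / s\<^sup>2"
      unfolding s_sq by simp
    finally show "(\<Sum>i = 1..n. expectation (\<lambda>\<omega>. (X i \<omega>)\<^sup>2)) = 1"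
      using \<open>0 < s\<close> by simp
  qed simp

  \<comment> \<open>The constant enters only through its quotient by \<open>s\<close>; the stated
    form of the exponent is recovered at the end by expanding the fraction by
    \<open>s\<close>.\<close>
  define c where "c = exp 1 * K_sup R \<sigma> / s"
  have c_ge: "20 * (R / s) \<le> c"
    unfolding c_def using K_sup_ge[OF assms(6) \<sigma>R] \<open>0 < s\<close> by (simp add: divide_right_mono)
  moreover have "0 < R / s"
    using \<sigma>R assms(6) \<open>0 < s\<close> by simp
  ultimately have "0 < c" by linarith
  have "AE \<omega> in M. \<forall>i\<in>{1..n}. Z i \<omega> = Y i \<omega>"
    by (intro AE_finite_allI) (auto intro: Z_AE)
  then have "AE \<omega> in M. S.W \<omega> = 1 / s * bridge M Y n k \<omega>"
  proof eventually_elim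
    case (elim \<omega>)
    have "X i \<omega> = 1 / s * (w i * centred M Y i \<omega>)" if "i \<in> {1..n}" for i
      using elim E_Y[of i "\<lambda>x. x"] that by (simp add: X_def centred_def \<mu>_def)
    then show ?case
      unfolding S.W_def using assms(8)
      by (simp add: bridge_eq_weighted_sum w_def sum_divide_distrib)
  qed
  then have "AE \<omega> in M. \<omega> \<in> {\<omega> \<in> space M. t \<le> 1 / s * bridge M Y n k \<omega>}
      \<longleftrightarrow> \<omega> \<in> {\<omega> \<in> space M. t \<le> S.W \<omega>}"
    by eventually_elim auto
  moreover have [measurable]: "bridge M Y n k \<in> borel_measurable M"
    unfolding bridge_def[abs_def] centred_sum_def centred_def by measurable
  have "{\<omega> \<in> space M. t \<le> 1 / s * bridge M Y n k \<omega>} \<in> events"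
    "{\<omega> \<in> space M. t \<le> S.W \<omega>} \<in> events"
    by measurable
  ultimately have "prob {\<omega> \<in> space M. t \<le> 1 / s * bridge M Y n k \<omega>} = prob {\<omega> \<in> space M. t \<le> S.W \<omega>}"
    by (rule measure_eq_AE)
  also have "\<dots> \<le> (std_normal_tail t + c * std_normal_density t)
    * (c * std_normal_density t) powr (- (c * (t + 1) / (c * (t + 1) + 1)))"
    using assms(9) by (intro S.prob_le_bound c_ge \<open>0 < c\<close>) (simp add: c_def s_def mult.assoc)
  also have "std_normal_tail t + c * std_normal_density t = std_normal_tail t
      * (1 + exp 1 * K_sup R \<sigma> * std_normal_density t / (std_normal_tail t * s))"
    using std_normal_tail_pos[of t] by (simp add: c_def field_simps)
  also have "c * std_normal_density t = exp 1 * K_sup R \<sigma> * std_normal_density t / s"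
    by (simp add: c_def)
  also have "c * (t + 1) / (c * (t + 1) + 1)
      = exp 1 * K_sup R \<sigma> * (t + 1) / (exp 1 * K_sup R \<sigma> * (t + 1) + s)"
  proof -
    have "c * (t + 1) / (c * (t + 1) + 1) = (s * (c * (t + 1))) / (s * (c * (t + 1) + 1))"
      using \<open>0 < s\<close> by simp
    also have "\<dots> = exp 1 * K_sup R \<sigma> * (t + 1) / (exp 1 * K_sup R \<sigma> * (t + 1) + s)"
      using \<open>0 < s\<close> by (simp add: c_def distrib_left)
    finally show ?thesis .
  qed
  finally show ?thesis
    unfolding s_def by simp
qed

end
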